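(* Let $P$ be an irreducible $\mathcal{K}_n$-module and let $V$ be an irreducible $\mathfrak{sl}_n$-module (not necessarily finite-dimensional or a weight module) which is not isomorphic to $V(\delta_k)$ for any $k=0,1,\dots,n-1$. Then the $\mathbb{S}_n$-module $\mathcal{F}(P,V)=P\otimes V$ is irreducible.
   Context: All algebras and vector spaces are over $\mathbb{C}$, and $n\ge 2$ is a fixed integer. Let $A_n=\mathbb{C}[x_1^{\pm1},\dots,x_n^{\pm1}]$, $\partial_i=x_i\frac{\partial}{\partial x_i}$, and $x^r=x_1^{r_1}\cdots x_n^{r_n}$ for $r=(r_1,\dots,r_n)^T\in\mathbb{Z}^n$. Let $\mathcal{K}_n$ be the Weyl algebra over $A_n$, i.e. the (unital associative) algebra of differential operators on $A_n$ generated by $A_n$ and $\partial_1,\dots,\partial_n$. Elements of $\mathbb{C}^n$ and $\mathbb{Z}^n$ are column vectors and $(u|v)=u^Tv$. For $u=(u_1,\dots,u_n)^T\in\mathbb{C}^n$ and $r\in\mathbb{Z}^n$ put $D(u,r)=x^r\sum_{i=1}^n u_i\partial_i$; these span the Witt algebra $W_n=\mathrm{Der}(A_n)$, with $[D(u,r),D(v,s)]=D(w,r+s)$, $w=(u|s)v-(v|r)u$. The Lie algebra of divergence zero vector fields on an $n$-dimensional torus is the Lie subalgebra $$\mathbb{S}_n=\mathrm{span}\{D(u,r)\mid u\in\mathbb{C}^n,\ r\in\mathbb{Z}^n,\ (u|r)=0\}\subseteq W_n .$$ For an $\mathfrak{sl}_n$-module $V$ and a $\mathcal{K}_n$-module $P$,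 let $\mathcal{F}(P,V)=P\otimes V$ with the $\mathbb{S}_n$-action $$D(u,r)(z\otimes y)=D(u,r)z\otimes y+x^rz\otimes (ru^T)y,\qquad z\in P,\ y\in V,\ (u|r)=0,$$ where $D(u,r)\in\mathcal{K}_n$ acts on $P$, and $ru^T$ is an $n\times n$ matrix which lies in $\mathfrak{sl}_n$ because $(u|r)=0$. $V(\delta_k)$ denotes the simple finite-dimensional $\mathfrak{sl}_n$-module whose highest weight is the fundamental weight $\delta_k$ ($\delta_k(h_j)=\delta_{k,j}$ for $h_j=E_{jj}-E_{j+1,j+1}$, $1\le j\le n-1$), with $\delta_0=0$; equivalently $V(\delta_k)\cong\bigwedge^k(\mathbb{C}^n)$, with $V(\delta_0)$ the trivial one-dimensional module. *)

theory Defs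
  imports
    "HOL-Analysis.Determinants"
    "HOL-Library.Poly_Mapping"
    "HOL-Library.Function_Algebras"
begin

section \<open>Complex vector spaces\<close>

class scaleC =
  fixes scaleC :: "complex \<Rightarrow> 'a \<Rightarrow> 'a" (infixr \<open>*\<^sub>C\<close> 75)

class complex_vector = scaleC + ab_group_add +
  assumes scaleC_add_right: "a *\<^sub>C (x + y) = a *\<^sub>C x + a *\<^sub>C y"
    and scaleC_add_left: "(a + b) *\<^sub>C x = a *\<^sub>C x + b *\<^sub>C x"
    and scaleC_scaleC: "a *\<^sub>C b *\<^sub>C x = (a * b) *\<^sub>C x"
    and scaleC_one: "1 *\<^sub>C x = x"

global_interpretation complex_vector: vector_space "scaleC :: complex \<Rightarrow> 'a \<Rightarrow> 'a::complex_vector"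
  defines csubspace = complex_vector.subspace
    and cspan = complex_vector.span
  by unfold_locales (simp_all add: scaleC_add_right scaleC_add_left scaleC_scaleC scaleC_one)

abbreviation clinear :: "('a::complex_vector \<Rightarrow> 'b::complex_vector) \<Rightarrow> bool"
  where "clinear \<equiv> Vector_Spaces.linear scaleC scaleC"

lemma clinear_iff:
  "clinear f \<longleftrightarrow> (\<forall>x y. f (x + y) = f x + f y) \<and> (\<forall>c x. f (c *\<^sub>C x) = c *\<^sub>C f x)"
  by (simp add: Vector_Spaces.linear_iff complex_vector.vector_space_axioms)

instantiation complex :: complex_vector
begin
definition scaleC_complex :: "complex \<Rightarrow> complex \<Rightarrow> complex"
  where [simp]: "scaleC_complex c x = c * x"
instance by standard (simp_all add: algebra_simps)
end

instantiation vec :: (complex_vector, finite) complex_vector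
begin
definition scaleC_vec :: "complex \<Rightarrow> 'a^'b \<Rightarrow> 'a^'b"
  where "scaleC_vec c x = (\<chi> i. c *\<^sub>C (x $ i))"
instance
  by standard (simp_all add: scaleC_vec_def vec_eq_iff scaleC_add_right scaleC_add_left
      scaleC_scaleC scaleC_one)
end

instantiation "fun" :: (type, complex_vector) complex_vector
begin
definition scaleC_fun :: "complex \<Rightarrow> ('a \<Rightarrow> 'b) \<Rightarrow> 'a \<Rightarrow> 'b"
  where "scaleC_fun c f = (\<lambda>x. c *\<^sub>C f x)"
instance
  by standard (simp_all add: scaleC_fun_def fun_eq_iff scaleC_add_right scaleC_add_left
      scaleC_scaleC scaleC_one)
end

instantiation poly_mapping :: (type, complex_vector) complex_vector
begin
lift_definition scaleC_poly_mapping :: "complex \<Rightarrow> ('a \<Rightarrow>\<^sub>0 'b) \<Rightarrow> 'a \<Rightarrow>\<^sub>0 'b"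
  is "\<lambda>c f k. c *\<^sub>C f k"
  by (rule rev_finite_subset, assumption) auto
instance
  by (standard; transfer)
    (simp_all add: fun_eq_iff scaleC_add_right scaleC_add_left scaleC_scaleC scaleC_one)
end

lemma scaleC_vec_nth [simp]: "(c *\<^sub>C x) $ i = c *\<^sub>C (x $ i)"
  by (simp add: scaleC_vec_def)

lemma scaleC_fun_apply [simp]: "(c *\<^sub>C f) x = c *\<^sub>C f x"
  by (simp add: scaleC_fun_def)

lemma lookup_scaleC [simp]: "Poly_Mapping.lookup (c *\<^sub>C f) k = c *\<^sub>C Poly_Mapping.lookup f k"
  by transfer simp

section \<open>Tensor products\<close>

text \<open>The free vector space on \<^typ>\<open>'a \<times> 'b\<close> modulo the span of the bilinearity relations.\<close>

definition tensor_relations :: "('a::complex_vector \<times> 'b::complex_vector \<Rightarrow>\<^sub>0 complex) set"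
  where "tensor_relations =
      {Poly_Mapping.single (x + x', y) 1 - Poly_Mapping.single (x, y) 1 - Poly_Mapping.single (x', y) 1
        | x x' y. True}
    \<union> {Poly_Mapping.single (x, y + y') 1 - Poly_Mapping.single (x, y) 1 - Poly_Mapping.single (x, y') 1
        | x y y'. True}
    \<union> {Poly_Mapping.single (c *\<^sub>C x, y) 1 - c *\<^sub>C Poly_Mapping.single (x, y) 1 | c x y. True}
    \<union> {Poly_Mapping.single (x, c *\<^sub>C y) 1 - c *\<^sub>C Poly_Mapping.single (x, y) 1 | c x y. True}"

definition tensor_eq ::
    "('a::complex_vector \<times> 'b::complex_vector \<Rightarrow>\<^sub>0 complex) \<Rightarrow> ('a \<times> 'b \<Rightarrow>\<^sub>0 complex) \<Rightarrow> bool"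
  where "tensor_eq f g \<longleftrightarrow> f - g \<in> cspan tensor_relations"

lemma tensor_eq_refl: "tensor_eq f f"
  by (simp add: tensor_eq_def complex_vector.span_zero)

lemma tensor_eq_add: "tensor_eq f g \<Longrightarrow> tensor_eq f' g' \<Longrightarrow> tensor_eq (f + f') (g + g')"
  unfolding tensor_eq_def add_diff_add by (rule complex_vector.span_add)

lemma tensor_eq_scale: "tensor_eq f g \<Longrightarrow> tensor_eq (c *\<^sub>C f) (c *\<^sub>C g)"
  unfolding tensor_eq_def complex_vector.scale_right_diff_distrib[symmetric]
  by (rule complex_vector.span_scale)

lemma tensor_eq_uminus: "tensor_eq f g \<Longrightarrow> tensor_eq (- f) (- g)"
  using tensor_eq_scale[of f g "- 1"] by simp

lemma equivp_tensor_eq: "equivp tensor_eq"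
proof (rule equivpI)
  show "reflp tensor_eq"
    by (simp add: reflp_def tensor_eq_refl)
  show "symp tensor_eq"
    unfolding symp_def tensor_eq_def by (metis complex_vector.span_neg minus_diff_eq)
  show "transp tensor_eq"
    by (rule transpI) (drule (1) tensor_eq_add, simp add: tensor_eq_def algebra_simps)
qed

quotient_type (overloaded) ('a, 'b) tensor =
    "('a::complex_vector \<times> 'b::complex_vector) \<Rightarrow>\<^sub>0 complex" / tensor_eq
  by (rule equivp_tensor_eq)

instantiation tensor :: (complex_vector, complex_vector) complex_vector
begin

lift_definition zero_tensor :: "('a, 'b) tensor" is 0 .

lift_definition plus_tensor :: "('a, 'b) tensor \<Rightarrow> ('a, 'b) tensor \<Rightarrow> ('a, 'b) tensor"
  is "(+)" by (rule tensor_eq_add)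

lift_definition uminus_tensor :: "('a, 'b) tensor \<Rightarrow> ('a, 'b) tensor"
  is uminus by (rule tensor_eq_uminus)

lift_definition minus_tensor :: "('a, 'b) tensor \<Rightarrow> ('a, 'b) tensor \<Rightarrow> ('a, 'b) tensor"
  is "(-)" by (metis tensor_eq_add tensor_eq_uminus diff_conv_add_uminus)

lift_definition scaleC_tensor :: "complex \<Rightarrow> ('a, 'b) tensor \<Rightarrow> ('a, 'b) tensor"
  is "(*\<^sub>C)" by (rule tensor_eq_scale)

instance
  by (standard; transfer)
    (simp_all add: tensor_eq_refl add_ac scaleC_add_left scaleC_add_right)

end

lift_definition pure_tensor :: "'a::complex_vector \<Rightarrow> 'b::complex_vector \<Rightarrow> ('a, 'b) tensor"
    (infixr \<open>\<otimes>\<^sub>t\<close> 70)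
  is "\<lambda>x y. Poly_Mapping.single (x, y) 1" .

definition bilinear_map ::
    "('a::complex_vector \<Rightarrow> 'b::complex_vector \<Rightarrow> 'c::complex_vector) \<Rightarrow> bool"
  where "bilinear_map b \<longleftrightarrow> (\<forall>x. clinear (b x)) \<and> (\<forall>y. clinear (\<lambda>x. b x y))"

lemma bilinear_pure_tensor: "bilinear_map (\<otimes>\<^sub>t)"
  unfolding bilinear_map_def clinear_iff
proof (intro conjI allI)
  fix x x' :: 'a and y y' :: 'b and c :: complex
  show "x \<otimes>\<^sub>t (y + y') = x \<otimes>\<^sub>t y + x \<otimes>\<^sub>t y'"
    by (transfer, unfold tensor_eq_def, rule complex_vector.span_base)
      (unfold tensor_relations_def diff_diff_eq[symmetric], blast)
  show "(x + x') \<otimes>\<^sub>t y = x \<otimes>\<^sub>t y + x' \<otimes>\<^sub>t y"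
    by (transfer, unfold tensor_eq_def, rule complex_vector.span_base)
      (unfold tensor_relations_def diff_diff_eq[symmetric], blast)
  show "x \<otimes>\<^sub>t (c *\<^sub>C y) = c *\<^sub>C (x \<otimes>\<^sub>t y)"
    by (transfer, unfold tensor_eq_def, rule complex_vector.span_base)
      (unfold tensor_relations_def, blast)
  show "(c *\<^sub>C x) \<otimes>\<^sub>t y = c *\<^sub>C (x \<otimes>\<^sub>t y)"
    by (transfer, unfold tensor_eq_def, rule complex_vector.span_base)
      (unfold tensor_relations_def, blast)
qed

text \<open>The linear map on the tensor product induced by a bilinear map \<open>b\<close>, computed on some
  representative in the free vector space; for bilinear \<open>b\<close> the choice is irrelevant,
  see \<open>tensor_lift_pure\<close> and \<open>clinear_tensor_lift\<close> below.\<close>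

definition free_lift :: "('a \<Rightarrow> 'b \<Rightarrow> 'c::complex_vector) \<Rightarrow> ('a \<times> 'b \<Rightarrow>\<^sub>0 complex) \<Rightarrow> 'c"
  where "free_lift b f = (\<Sum>k\<in>Poly_Mapping.keys f. Poly_Mapping.lookup f k *\<^sub>C b (fst k) (snd k))"

definition tensor_lift ::
    "('a::complex_vector \<Rightarrow> 'b::complex_vector \<Rightarrow> 'c::complex_vector) \<Rightarrow> ('a, 'b) tensor \<Rightarrow> 'c"
  where "tensor_lift b t = free_lift b (rep_tensor t)"

lemma free_lift_superset:
  assumes "finite S" "Poly_Mapping.keys f \<subseteq> S"
  shows "free_lift b f = (\<Sum>k\<in>S. Poly_Mapping.lookup f k *\<^sub>C b (fst k) (snd k))"
  unfolding free_lift_def using assms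
  by (intro sum.mono_neutral_left) (auto simp: in_keys_iff)

lemma clinear_free_lift: "clinear (free_lift b)"
  unfolding clinear_iff
proof (intro conjI allI)
  fix f g :: "'a \<times> 'b \<Rightarrow>\<^sub>0 complex" and c :: complex
  let ?S = "Poly_Mapping.keys f \<union> Poly_Mapping.keys g"
  have "free_lift b (f + g) = (\<Sum>k\<in>?S. Poly_Mapping.lookup (f + g) k *\<^sub>C b (fst k) (snd k))"
    by (rule free_lift_superset) (use keys_add[of f g] in auto)
  also have "\<dots> = free_lift b f + free_lift b g"
    by (subst (1 2) free_lift_superset[of ?S])
      (auto simp: lookup_add scaleC_add_left sum.distrib)
  finally show "free_lift b (f + g) = free_lift b f + free_lift b g" .
  have "free_lift b (c *\<^sub>C f) = (\<Sum>k\<in>Poly_Mapping.keys f.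
        Poly_Mapping.lookup (c *\<^sub>C f) k *\<^sub>C b (fst k) (snd k))"
    by (rule free_lift_superset) (auto simp: in_keys_iff)
  also have "\<dots> = c *\<^sub>C free_lift b f"
    by (simp add: free_lift_def complex_vector.scale_sum_right)
  finally show "free_lift b (c *\<^sub>C f) = c *\<^sub>C free_lift b f" .
qed

lemma clinear_0: "clinear f \<Longrightarrow> f 0 = 0"
  and clinear_diff: "clinear f \<Longrightarrow> f (x - y) = f x - f y"
  and clinear_sum: "clinear f \<Longrightarrow> f (sum g S) = (\<Sum>k\<in>S. f (g k))"
proof -
  assume f: "clinear f"
  interpret module_hom "scaleC :: complex \<Rightarrow> 'a \<Rightarrow> 'a" "scaleC :: complex \<Rightarrow> 'b \<Rightarrow> 'b" f
    using f by (simp add: Vector_Spaces.linear_def)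
  show "f 0 = 0" "f (x - y) = f x - f y" "f (sum g S) = (\<Sum>k\<in>S. f (g k))"
    by (simp_all add: zero diff sum)
qed

lemma clinear_add: "clinear f \<Longrightarrow> f (x + y) = f x + f y"
  and clinear_scale: "clinear f \<Longrightarrow> f (c *\<^sub>C x) = c *\<^sub>C f x"
  by (simp_all add: clinear_iff)

lemma free_lift_single: "free_lift b (Poly_Mapping.single (x, y) c) = c *\<^sub>C b x y"
  by (simp add: free_lift_def)

lemma free_lift_relations:
  assumes "bilinear_map b" "f \<in> cspan tensor_relations"
  shows "free_lift b f = 0"
  using assms(2)
proof (induction rule: complex_vector.span_induct_alt)
  case base
  show ?case by (rule clinear_0[OF clinear_free_lift])
next
  case (step c x y)
  have "free_lift b x = 0"
    using step(1) assms(1) clinear_diff[OF clinear_free_lift[of b]]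
    by (auto simp: tensor_relations_def bilinear_map_def free_lift_single clinear_iff
        clinear_scale[OF clinear_free_lift])
  with step show ?case
    by (simp add: clinear_add[OF clinear_free_lift] clinear_scale[OF clinear_free_lift])
qed

lemma tensor_lift_abs:
  assumes "bilinear_map b"
  shows "tensor_lift b (abs_tensor f) = free_lift b f"
proof -
  have "tensor_eq (rep_tensor (abs_tensor f)) f"
    by (rule Quotient3_rep_abs[OF Quotient3_tensor])
      (simp add: tensor_eq_def complex_vector.span_zero)
  then have "free_lift b (rep_tensor (abs_tensor f) - f) = 0"
    unfolding tensor_eq_def by (rule free_lift_relations[OF assms])
  then show ?thesis
    by (simp add: tensor_lift_def clinear_diff[OF clinear_free_lift])
qed

lemma tensor_lift_pure: "bilinear_map b \<Longrightarrow> tensor_lift b (x \<otimes>\<^sub>t y) = b x y"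
  by (simp add: pure_tensor.abs_eq tensor_lift_abs free_lift_single scaleC_one)

lemma clinear_tensor_lift:
  assumes "bilinear_map b"
  shows "clinear (tensor_lift b)"
  unfolding clinear_iff
proof (intro conjI allI)
  fix s t :: "('a, 'b) tensor" and c :: complex
  obtain f g where "s = abs_tensor f" "t = abs_tensor g"
    using Quotient3_abs_rep[OF Quotient3_tensor] by metis
  then show "tensor_lift b (s + t) = tensor_lift b s + tensor_lift b t"
    "tensor_lift b (c *\<^sub>C s) = c *\<^sub>C tensor_lift b s"
    by (simp_all add: plus_tensor.abs_eq scaleC_tensor.abs_eq tensor_lift_abs[OF assms]
        clinear_add[OF clinear_free_lift] clinear_scale[OF clinear_free_lift])
qed

section \<open>Modules and irreducibility\<close>

text \<open>An algebra \<open>L\<close> is a subset of a vector space; an action is a function on the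
  whole ambient type of which only the values on \<open>L\<close> matter.\<close>

definition submodule ::
    "'l set \<Rightarrow> ('l \<Rightarrow> 'v::complex_vector \<Rightarrow> 'v) \<Rightarrow> 'v set \<Rightarrow> bool"
  where "submodule L \<rho> M \<longleftrightarrow> csubspace M \<and> (\<forall>X\<in>L. \<forall>v\<in>M. \<rho> X v \<in> M)"

definition irreducible_action :: "'l set \<Rightarrow> ('l \<Rightarrow> 'v::complex_vector \<Rightarrow> 'v) \<Rightarrow> bool"
  where "irreducible_action L \<rho> \<longleftrightarrow>
    (\<exists>v::'v. v \<noteq> 0) \<and> (\<forall>M. submodule L \<rho> M \<longrightarrow> M = {0} \<or> M = UNIV)"

definition linear_action ::
    "'l::complex_vector set \<Rightarrow> ('l \<Rightarrow> 'v::complex_vector \<Rightarrow> 'v) \<Rightarrow> bool"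
  where "linear_action L \<rho> \<longleftrightarrow>
    (\<forall>X\<in>L. clinear (\<rho> X)) \<and>
    (\<forall>X\<in>L. \<forall>Y\<in>L. \<forall>v. \<rho> (X + Y) v = \<rho> X v + \<rho> Y v) \<and>
    (\<forall>c. \<forall>X\<in>L. \<forall>v. \<rho> (c *\<^sub>C X) v = c *\<^sub>C \<rho> X v)"

definition lie_module ::
    "'l::complex_vector set \<Rightarrow> ('l \<Rightarrow> 'l \<Rightarrow> 'l) \<Rightarrow> ('l \<Rightarrow> 'v::complex_vector \<Rightarrow> 'v) \<Rightarrow> bool"
  where "lie_module L br \<rho> \<longleftrightarrow> linear_action L \<rho> \<and>
    (\<forall>X\<in>L. \<forall>Y\<in>L. \<forall>v. \<rho> (br X Y) v = \<rho> X (\<rho> Y v) - \<rho> Y (\<rho> X v))"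

definition module_isomorphic ::
    "'l set \<Rightarrow> ('l \<Rightarrow> 'v::complex_vector \<Rightarrow> 'v) \<Rightarrow> ('l \<Rightarrow> 'w::complex_vector \<Rightarrow> 'w) \<Rightarrow> bool"
  where "module_isomorphic L \<rho> \<sigma> \<longleftrightarrow>
    (\<exists>f. clinear f \<and> bij f \<and> (\<forall>X\<in>L. \<forall>v. f (\<rho> X v) = \<sigma> X (f v)))"

section \<open>Laurent polynomials, differential operators and divergence zero vector fields\<close>

text \<open>The group algebra of \<open>\<int>\<^sup>n\<close>; the product on \<^type>\<open>poly_mapping\<close> is convolution.\<close>

type_synonym 'n laurent = "(int^'n) \<Rightarrow>\<^sub>0 complex"
type_synonym 'n operator = "'n laurent \<Rightarrow> 'n laurent"

abbreviation xpow :: "int^'n \<Rightarrow> 'n::finite laurent"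
  where "xpow r \<equiv> Poly_Mapping.single r 1"

text \<open>\<open>\<partial>\<^sub>i = x\<^sub>i \<partial>/\<partial>x\<^sub>i\<close>, i.e. \<open>x\<^sup>r \<mapsto> r\<^sub>i x\<^sup>r\<close>.\<close>

lift_definition partial :: "'n::finite \<Rightarrow> 'n operator"
  is "\<lambda>i f r. of_int (r $ i) * f r"
  by (rule rev_finite_subset, assumption) auto

inductive_set weyl_algebra :: "'n::finite operator set"
  where
    multiplication: "(\<lambda>g. f * g) \<in> weyl_algebra"
  | derivation: "partial i \<in> weyl_algebra"
  | add: "X \<in> weyl_algebra \<Longrightarrow> Y \<in> weyl_algebra \<Longrightarrow> X + Y \<in> weyl_algebra"
  | scale: "X \<in> weyl_algebra \<Longrightarrow> c *\<^sub>C X \<in> weyl_algebra"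
  | compose: "X \<in> weyl_algebra \<Longrightarrow> Y \<in> weyl_algebra \<Longrightarrow> X \<circ> Y \<in> weyl_algebra"

definition weyl_module :: "('n::finite operator \<Rightarrow> 'p::complex_vector \<Rightarrow> 'p) \<Rightarrow> bool"
  where "weyl_module \<pi> \<longleftrightarrow> linear_action weyl_algebra \<pi> \<and>
    (\<forall>z. \<pi> id z = z) \<and>
    (\<forall>X\<in>weyl_algebra. \<forall>Y\<in>weyl_algebra. \<forall>z. \<pi> (X \<circ> Y) z = \<pi> X (\<pi> Y z))"

definition pairing :: "complex^'n \<Rightarrow> int^'n \<Rightarrow> complex"
  where "pairing u r = (\<Sum>i\<in>UNIV. u $ i * of_int (r $ i))"

definition D_op :: "complex^'n \<Rightarrow> int^'n \<Rightarrow> 'n::finite operator"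
  where "D_op u r = (\<lambda>g. xpow r * (\<Sum>i\<in>UNIV. (u $ i) *\<^sub>C partial i g))"

definition S_alg :: "'n::finite operator set"
  where "S_alg = cspan {D_op u r | u r. pairing u r = 0}"

definition op_bracket :: "'n::finite operator \<Rightarrow> 'n operator \<Rightarrow> 'n operator"
  where "op_bracket X Y = (X \<circ> Y) - (Y \<circ> X)"

section \<open>The special linear Lie algebra and its fundamental modules\<close>

type_synonym 'n sqmat = "complex^'n^'n"

definition sl :: "'n::finite sqmat set"
  where "sl = {A. trace A = 0}"

definition mat_bracket :: "'n::finite sqmat \<Rightarrow> 'n sqmat \<Rightarrow> 'n sqmat"
  where "mat_bracket A B = A ** B - B ** A"

definition matrix_unit :: "'n::finite \<Rightarrow> 'n \<Rightarrow> 'n sqmat"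
  where "matrix_unit i j = (\<chi> a b. if a = i \<and> b = j then 1 else 0)"

text \<open>The \<open>j\<close>-th smallest index, \<open>1 \<le> j \<le> n\<close>.\<close>

definition nth_index :: "nat \<Rightarrow> 'n::{finite,linorder}"
  where "nth_index j = sorted_list_of_set UNIV ! (j - 1)"

definition coroot :: "nat \<Rightarrow> 'n::{finite,linorder} sqmat"
  where "coroot j = matrix_unit (nth_index j) (nth_index j) - matrix_unit (nth_index (j + 1)) (nth_index (j + 1))"

text \<open>\<open>is_V_delta k \<rho>\<close>: the action \<open>\<rho>\<close> is a realisation of \<open>V(\<delta>\<^sub>k)\<close> on the vector space \<^typ>\<open>'v\<close>,
  i.e. a simple finite-dimensional module whose highest weight (with respect to the upper
  triangular matrices) is \<open>\<delta>\<^sub>k\<close>. A module isomorphic to \<open>V(\<delta>\<^sub>k)\<close> carries such a realisation on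
  its own underlying space, by transport of structure.\<close>

definition is_V_delta ::
    "nat \<Rightarrow> ('n::{finite,linorder} sqmat \<Rightarrow> 'v::complex_vector \<Rightarrow> 'v) \<Rightarrow> bool"
  where "is_V_delta k \<rho> \<longleftrightarrow>
    lie_module sl mat_bracket \<rho> \<and> irreducible_action sl \<rho> \<and>
    (\<exists>B::'v set. finite B \<and> cspan B = UNIV) \<and>
    (\<exists>v. v \<noteq> 0 \<and> (\<forall>i j. i < j \<longrightarrow> \<rho> (matrix_unit i j) v = 0) \<and>
      (\<forall>j\<in>{1..CARD('n) - 1}. \<rho> (coroot j) v = (if j = k then 1 else 0) *\<^sub>C v))"

section \<open>The module \<open>\<F>(P, V)\<close>\<close>

text \<open>The matrix \<open>r u\<^sup>T\<close>.\<close>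

definition outer :: "int^'n \<Rightarrow> complex^'n \<Rightarrow> 'n::finite sqmat"
  where "outer r u = (\<chi> i j. of_int (r $ i) * u $ j)"

text \<open>The vector field \<open>X = \<Sum>\<^sub>s D(u\<^sub>s, s)\<close> satisfies \<open>X x\<^sub>j = \<Sum>\<^sub>s u\<^sub>s\<^sub>,\<^sub>j x\<^sup>s x\<^sub>j\<close>, so \<open>u\<^sub>s\<close> is recovered
  as \<open>field_coeff X s\<close>. In this way \<open>F_action\<close> is the linear extension of
  the formula for \<open>D(u, r)\<close>, see \<open>F_action_D\<close> below.\<close>

definition field_coeff :: "'n::finite operator \<Rightarrow> int^'n \<Rightarrow> complex^'n"
  where "field_coeff X s = (\<chi> j. Poly_Mapping.lookup (X (xpow (axis j 1))) (s + axis j 1))"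

definition F_action ::
    "('n::finite operator \<Rightarrow> 'p::complex_vector \<Rightarrow> 'p) \<Rightarrow>
     ('n sqmat \<Rightarrow> 'v::complex_vector \<Rightarrow> 'v) \<Rightarrow>
     'n operator \<Rightarrow> ('p, 'v) tensor \<Rightarrow> ('p, 'v) tensor"
  where "F_action \<pi> \<rho> X = tensor_lift (\<lambda>z y. \<pi> X z \<otimes>\<^sub>t y +
    (\<Sum>s | field_coeff X s \<noteq> 0. \<pi> (\<lambda>g. xpow s * g) z \<otimes>\<^sub>t \<rho> (outer s (field_coeff X s)) y))"


text \<open>The remaining lemmas check the definition: \<open>F_action\<close> is given by the expected formula
  on the generators \<open>D(u, r)\<close> and makes the tensor product a module over \<open>S_alg\<close>.\<close>

lemma lookup_xpow_times:
  "Poly_Mapping.lookup (xpow r * g) s = Poly_Mapping.lookup g (s - r)"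
  for g :: "'n::finite laurent"
proof -
  have "s = r + q \<longleftrightarrow> q = s - r" for q by (auto simp: algebra_simps)
  then show ?thesis by (simp add: lookup_mult lookup_single when_mult)
qed

lemma sum_lookup:
  "Poly_Mapping.lookup (sum f S) k = (\<Sum>i\<in>S. Poly_Mapping.lookup (f i) k)"
  by (induction S rule: infinite_finite_induct) (simp_all add: lookup_add)

lemma lookup_D_op:
  "Poly_Mapping.lookup (D_op u r g) s = pairing u (s - r) * Poly_Mapping.lookup g (s - r)"
  by (simp add: D_op_def lookup_xpow_times sum_lookup partial.rep_eq pairing_def
      sum_distrib_right mult.assoc)

lemma zero_in_weyl: "0 \<in> weyl_algebra"
proof -
  have "(*) 0 = (0 :: 'n::finite operator)" by (simp add: fun_eq_iff)
  then show ?thesis using weyl_algebra.multiplication[of 0] by metis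
qed

lemma D_op_in_weyl: "D_op u r \<in> weyl_algebra"
proof -
  have "(\<Sum>i\<in>S. (u $ i) *\<^sub>C partial i) \<in> weyl_algebra" for S
    by (induction S rule: infinite_finite_induct)
      (auto intro: weyl_algebra.intros zero_in_weyl
        simp del: plus_fun_apply zero_fun_apply scaleC_fun_apply)
  then have "(\<lambda>g. xpow r * g) \<circ> (\<Sum>i\<in>UNIV. (u $ i) *\<^sub>C partial i) \<in> weyl_algebra"
    by (intro weyl_algebra.intros)
  moreover have "(\<Sum>i\<in>S. (u $ i) *\<^sub>C partial i) g = (\<Sum>i\<in>S. (u $ i) *\<^sub>C partial i g)" for S g
    by (induction S rule: infinite_finite_induct) simp_all
  ultimately show ?thesis
    by (simp add: D_op_def comp_def)
qed

lemma S_alg_induct [consumes 1, case_names zero step]: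
  fixes X :: "'n::finite operator"
  assumes "X \<in> S_alg"
    and "P 0"
    and "\<And>c u r Y. pairing u r = 0 \<Longrightarrow> Y \<in> S_alg \<Longrightarrow> P Y \<Longrightarrow> P (c *\<^sub>C D_op u r + Y)"
  shows "P X"
proof -
  let ?G = "{D_op u r | (u::complex^'n) r. pairing u r = 0}"
  have "X \<in> cspan ?G \<and> P X"
  proof (rule complex_vector.span_induct_alt[where h = "\<lambda>X. X \<in> cspan ?G \<and> P X"])
    show "X \<in> cspan ?G" using assms(1) by (simp add: S_alg_def)
    show "0 \<in> cspan ?G \<and> P 0" using assms(2) by (simp add: complex_vector.span_zero)
    fix c and X Y :: "'n operator"
    assume X: "X \<in> ?G" and Y: "Y \<in> cspan ?G \<and> P Y"
    from X obtain u r where "X = D_op u r" "pairing u r = 0" by blast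
    with Y assms(3)[of u r Y c] have "P (c *\<^sub>C X + Y)" by (simp add: S_alg_def)
    moreover have "c *\<^sub>C X + Y \<in> cspan ?G"
      using Y by (blast intro: complex_vector.span_add complex_vector.span_scale
          complex_vector.span_base[OF X])
    ultimately show "c *\<^sub>C X + Y \<in> cspan ?G \<and> P (c *\<^sub>C X + Y)" by simp
  qed
  then show ?thesis by simp
qed

lemma D_op_in_S_alg: "pairing u r = 0 \<Longrightarrow> D_op u r \<in> S_alg"
  unfolding S_alg_def by (rule complex_vector.span_base) blast

lemma S_alg_add: "X \<in> S_alg \<Longrightarrow> Y \<in> S_alg \<Longrightarrow> X + Y \<in> S_alg"
  and S_alg_scale: "X \<in> S_alg \<Longrightarrow> c *\<^sub>C X \<in> S_alg"
  and S_alg_zero: "0 \<in> S_alg"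
  and S_alg_diff: "X \<in> S_alg \<Longrightarrow> Y \<in> S_alg \<Longrightarrow> X - Y \<in> S_alg"
  unfolding S_alg_def
  by (simp_all add: complex_vector.span_add complex_vector.span_scale complex_vector.span_zero
      complex_vector.span_diff)

lemma S_alg_subset_weyl: "X \<in> S_alg \<Longrightarrow> X \<in> weyl_algebra"
  by (rule S_alg_induct[where P = "\<lambda>X. X \<in> weyl_algebra"])
    (auto intro: weyl_algebra.intros D_op_in_weyl zero_in_weyl
      simp del: plus_fun_apply zero_fun_apply scaleC_fun_apply)

lemma pairing_axis: "pairing u (axis j 1) = u $ j"
proof -
  have "pairing u (axis j 1) = (\<Sum>i\<in>UNIV. if i = j then u $ i else 0)"
    unfolding pairing_def by (rule sum.cong) (auto simp: axis_def)
  then show ?thesis by simp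
qed

lemma field_coeff_D_op: "field_coeff (D_op u r) s = (if s = r then u else 0)"
proof (cases "s = r")
  case True
  have "s + a - s = a" for a :: "int^'a" by simp
  then show ?thesis
    by (simp add: True field_coeff_def lookup_D_op pairing_axis vec_eq_iff del: vector_minus_component)
next
  case False
  then have "a \<noteq> s + a - r" for a :: "int^'a"
    by (simp add: algebra_simps del: vec_eq_iff)
  with False show ?thesis
    by (simp add: field_coeff_def lookup_D_op lookup_single when_def zero_vec_def)
qed

lemma field_coeff_add: "field_coeff (X + Y) s = field_coeff X s + field_coeff Y s"
  and field_coeff_scale: "field_coeff (c *\<^sub>C X) s = c *\<^sub>C field_coeff X s"
  and field_coeff_zero: "field_coeff 0 s = 0"
  by (simp_all add: field_coeff_def vec_eq_iff lookup_add)

lemma finite_field_coeff: "finite {s. field_coeff X s \<noteq> 0}"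
proof (rule finite_subset)
  show "{s. field_coeff X s \<noteq> 0}
      \<subseteq> (\<Union>j. (\<lambda>t. t - axis j 1) ` Poly_Mapping.keys (X (xpow (axis j 1))))"
  proof
    fix s assume "s \<in> {s. field_coeff X s \<noteq> 0}"
    then obtain j where "Poly_Mapping.lookup (X (xpow (axis j 1))) (s + axis j 1) \<noteq> 0"
      by (auto simp: field_coeff_def vec_eq_iff)
    then show "s \<in> (\<Union>j. (\<lambda>t. t - axis j 1) ` Poly_Mapping.keys (X (xpow (axis j 1))))"
      by (intro UN_I[of j] image_eqI[of _ _ "s + axis j 1"]) (auto simp: in_keys_iff)
  qed
qed auto

lemma outer_add: "outer s (u + v) = outer s u + outer s v"
  and outer_scale: "outer s (c *\<^sub>C u) = c *\<^sub>C outer s u"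
  and outer_zero: "outer s 0 = 0"
  by (simp_all add: outer_def vec_eq_iff algebra_simps)

lemma outer_in_sl: "outer s u \<in> sl \<longleftrightarrow> pairing u s = 0"
  by (simp add: sl_def trace_def outer_def pairing_def mult.commute)

lemma pairing_add: "pairing (u + v) s = pairing u s + pairing v s"
  and pairing_diff: "pairing (u - v) s = pairing u s - pairing v s"
  and pairing_scale: "pairing (c *\<^sub>C u) s = c * pairing u s"
  and pairing_zero: "pairing 0 s = 0"
  and pairing_add_right: "pairing u (r + s) = pairing u r + pairing u s"
  by (simp_all add: pairing_def algebra_simps sum.distrib sum_subtractf sum_distrib_left)

lemma pairing_field_coeff: "X \<in> S_alg \<Longrightarrow> pairing (field_coeff X s) s = 0"
  by (rule S_alg_induct[where P = "\<lambda>X. pairing (field_coeff X s) s = 0"])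
    (auto simp: field_coeff_add field_coeff_scale field_coeff_zero field_coeff_D_op
      pairing_add pairing_scale pairing_zero
      simp del: plus_fun_apply zero_fun_apply scaleC_fun_apply)

lemma bilinear_map_add: "bilinear_map b \<Longrightarrow> bilinear_map c \<Longrightarrow> bilinear_map (\<lambda>x y. b x y + c x y)"
  by (simp add: bilinear_map_def clinear_iff scaleC_add_right algebra_simps)

lemma bilinear_map_sum:
  assumes "\<And>i. i \<in> S \<Longrightarrow> bilinear_map (b i)"
  shows "bilinear_map (\<lambda>x y. \<Sum>i\<in>S. b i x y)"
  using assms
proof (induction S rule: infinite_finite_induct)
  case (insert i S)
  then show ?case by (simp add: bilinear_map_add)
qed (simp_all add: bilinear_map_def clinear_iff)

lemma clinear_pure_tensor: "clinear ((\<otimes>\<^sub>t) x)" "clinear (\<lambda>x. x \<otimes>\<^sub>t y)"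
  using bilinear_pure_tensor unfolding bilinear_map_def by blast+

lemmas pure_tensor_zero =
  clinear_0[OF clinear_pure_tensor(1)] clinear_0[OF clinear_pure_tensor(2)]

lemmas pure_tensor_linear =
  clinear_add[OF clinear_pure_tensor(1)] clinear_add[OF clinear_pure_tensor(2)]
  clinear_diff[OF clinear_pure_tensor(1)] clinear_diff[OF clinear_pure_tensor(2)]
  clinear_scale[OF clinear_pure_tensor(1)] clinear_scale[OF clinear_pure_tensor(2)]

lemma bilinear_map_pure:
  "clinear f \<Longrightarrow> clinear g \<Longrightarrow> bilinear_map (\<lambda>x y. f x \<otimes>\<^sub>t g y)"
  by (simp add: bilinear_map_def clinear_iff pure_tensor_linear)

lemma tensor_span:
  "t \<in> cspan {x \<otimes>\<^sub>t y | x y. True}" for t :: "('a::complex_vector, 'b::complex_vector) tensor"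
proof -
  let ?P = "cspan {x \<otimes>\<^sub>t y | (x::'a) (y::'b). True}"
  have span: "abs_tensor (\<Sum>k\<in>S. c k *\<^sub>C Poly_Mapping.single k 1) \<in> ?P" for S and c :: "'a \<times> 'b \<Rightarrow> complex"
  proof (induction S rule: infinite_finite_induct)
    case (insert k S)
    have "abs_tensor (c k *\<^sub>C Poly_Mapping.single k 1) = c k *\<^sub>C (fst k \<otimes>\<^sub>t snd k)"
      by (simp add: scaleC_tensor.abs_eq pure_tensor.abs_eq)
    then have "abs_tensor (c k *\<^sub>C Poly_Mapping.single k 1) \<in> ?P"
      by (auto intro: complex_vector.span_scale complex_vector.span_base)
    with insert show ?case
      by (simp add: plus_tensor.abs_eq[symmetric] complex_vector.span_add)
  qed (simp_all add: zero_tensor_def[symmetric] complex_vector.span_zero)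
  obtain f where t: "t = abs_tensor f"
    using Quotient3_abs_rep[OF Quotient3_tensor, of t] by metis
  have f: "(\<Sum>k\<in>Poly_Mapping.keys f. Poly_Mapping.lookup f k *\<^sub>C Poly_Mapping.single k 1) = f"
    by (rule poly_mapping_eqI)
      (simp add: sum_lookup lookup_single when_def if_distrib[of "\<lambda>x. _ * x"] in_keys_iff
        cong: if_cong)
  show ?thesis
    using span[of "Poly_Mapping.lookup f" "Poly_Mapping.keys f"] by (simp only: f t)
qed

lemma tensor_ext:
  assumes "clinear f" "clinear g" "\<And>x y. f (x \<otimes>\<^sub>t y) = g (x \<otimes>\<^sub>t y)"
  shows "f t = g t"
proof -
  have "t \<in> cspan {x \<otimes>\<^sub>t y | x y. True}" by (rule tensor_span)
  then show ?thesis
  proof (induction rule: complex_vector.span_induct_alt)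
    case base
    show ?case by (simp add: clinear_0[OF assms(1)] clinear_0[OF assms(2)])
  next
    case (step c x y)
    then show ?case using assms by (auto simp: clinear_iff)
  qed
qed

lemma clinear_plus: "clinear f \<Longrightarrow> clinear g \<Longrightarrow> clinear (\<lambda>x. f x + g x)"
  and clinear_minus: "clinear f \<Longrightarrow> clinear g \<Longrightarrow> clinear (\<lambda>x. f x - g x)"
  and clinear_scaled: "clinear f \<Longrightarrow> clinear (\<lambda>x. c *\<^sub>C f x)"
  and clinear_comp: "clinear f \<Longrightarrow> clinear g \<Longrightarrow> clinear (\<lambda>x. f (g x))"
  by (simp_all add: clinear_iff algebra_simps complex_vector.scale_right_distrib
      complex_vector.scale_right_diff_distrib complex_vector.scale_left_commute)

lemma xpow_xpow: "xpow r * xpow s = xpow (r + s)"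
  by (simp add: mult_single)

lemma op_bracket_D_op:
  fixes u v :: "complex^'n::finite"
  shows "op_bracket (D_op u r) (D_op v s) = D_op (pairing u s *\<^sub>C v - pairing v r *\<^sub>C u) (r + s)"
proof (rule ext, rule poly_mapping_eqI)
  fix g :: "'n laurent" and t :: "int^'n"
  have split: "pairing w (t - p) = pairing w (t - p - q) + pairing w q" 
    for w :: "complex^'n" and p q
    by (metis diff_add_cancel pairing_add_right)
  show "Poly_Mapping.lookup (op_bracket (D_op u r) (D_op v s) g) t
      = Poly_Mapping.lookup (D_op (pairing u s *\<^sub>C v - pairing v r *\<^sub>C u) (r + s) g) t"
    using split[of u r s] split[of v s r]
    by (simp add: op_bracket_def lookup_D_op lookup_minus pairing_diff pairing_scale
        diff_diff_eq add.commute[of s r] algebra_simps)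
qed

lemma D_op_comp_xpow:
  fixes u :: "complex^'n::finite"
  shows "D_op u r \<circ> (\<lambda>g. xpow s * g)
    = ((\<lambda>g. xpow s * g) \<circ> D_op u r) + pairing u s *\<^sub>C (\<lambda>g. xpow (r + s) * g)"
proof (rule ext, rule poly_mapping_eqI)
  fix g :: "'n laurent" and t :: "int^'n"
  have "pairing u (t - r) = pairing u (t - r - s) + pairing u s"
    by (metis diff_add_cancel pairing_add_right)
  moreover have "t - s - r = t - r - s" by simp
  ultimately show "Poly_Mapping.lookup ((D_op u r \<circ> (\<lambda>g. xpow s * g)) g) t
      = Poly_Mapping.lookup ((((\<lambda>g. xpow s * g) \<circ> D_op u r)
          + pairing u s *\<^sub>C (\<lambda>g. xpow (r + s) * g)) g) t"
    by (simp only: comp_apply plus_fun_apply scaleC_fun_apply lookup_add lookup_scaleC lookup_D_op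
        lookup_xpow_times scaleC_complex_def diff_diff_eq[symmetric] distrib_right)
qed

lemma op_bracket_in_S_alg:
  "pairing u r = 0 \<Longrightarrow> pairing v s = 0 \<Longrightarrow> op_bracket (D_op u r) (D_op v s) \<in> S_alg"
  unfolding op_bracket_D_op
  by (rule D_op_in_S_alg) (simp add: pairing_diff pairing_scale pairing_add_right mult.commute)

lemma outer_bracket:
  fixes u v :: "complex^'n"
  shows "outer (r + s) (pairing u s *\<^sub>C v - pairing v r *\<^sub>C u)
    = pairing u s *\<^sub>C outer s v - pairing v r *\<^sub>C outer r u
      + mat_bracket (outer r u) (outer s v)"
proof -
  have "(outer r u ** outer s v) $ i $ j = of_int (r $ i) * pairing u s * v $ j" for r s u v and i j :: 'n
    by (simp add: matrix_matrix_mult_def outer_def pairing_def sum_distrib_left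
        sum_distrib_right mult_ac)
  then show ?thesis
    by (simp add: vec_eq_iff mat_bracket_def) (auto simp add: outer_def algebra_simps)
qed

context
  fixes \<pi> :: "'n::finite operator \<Rightarrow> 'p::complex_vector \<Rightarrow> 'p"
    and \<rho> :: "'n sqmat \<Rightarrow> 'v::complex_vector \<Rightarrow> 'v"
  assumes \<pi>: "weyl_module \<pi>" and \<rho>: "lie_module sl mat_bracket \<rho>"
begin

private abbreviation (input) "mon s \<equiv> (\<lambda>g. xpow s * g) :: 'n operator"

private lemma \<pi>_linear: "X \<in> weyl_algebra \<Longrightarrow> clinear (\<pi> X)"
  and \<pi>_add: "X \<in> weyl_algebra \<Longrightarrow> Y \<in> weyl_algebra \<Longrightarrow> \<pi> (X + Y) z = \<pi> X z + \<pi> Y z"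
  and \<pi>_scale: "X \<in> weyl_algebra \<Longrightarrow> \<pi> (c *\<^sub>C X) z = c *\<^sub>C \<pi> X z"
  and \<pi>_comp: "X \<in> weyl_algebra \<Longrightarrow> Y \<in> weyl_algebra \<Longrightarrow> \<pi> (X \<circ> Y) z = \<pi> X (\<pi> Y z)"
  using \<pi> by (simp_all add: weyl_module_def linear_action_def)

private lemma \<rho>_linear: "A \<in> sl \<Longrightarrow> clinear (\<rho> A)"
  and \<rho>_add: "A \<in> sl \<Longrightarrow> B \<in> sl \<Longrightarrow> \<rho> (A + B) y = \<rho> A y + \<rho> B y"
  and \<rho>_scale: "A \<in> sl \<Longrightarrow> \<rho> (c *\<^sub>C A) y = c *\<^sub>C \<rho> A y"
  and \<rho>_bracket: "A \<in> sl \<Longrightarrow> B \<in> sl \<Longrightarrow>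
    \<rho> (mat_bracket A B) y = \<rho> A (\<rho> B y) - \<rho> B (\<rho> A y)"
  using \<rho> by (simp_all add: lie_module_def linear_action_def)

private lemma \<rho>_zero: "\<rho> 0 y = 0"
  using \<rho>_scale[of 0 0 y] by (simp add: sl_def trace_def)

private lemma F_bilinear:
  assumes "X \<in> S_alg"
  shows "bilinear_map (\<lambda>z y. \<pi> X z \<otimes>\<^sub>t y +
    (\<Sum>s | field_coeff X s \<noteq> 0. \<pi> (mon s) z \<otimes>\<^sub>t \<rho> (outer s (field_coeff X s)) y))"
proof (intro bilinear_map_add bilinear_map_sum)
  have "clinear (\<lambda>y. y)" by (simp add: clinear_iff)
  then show "bilinear_map (\<lambda>z y. \<pi> X z \<otimes>\<^sub>t (y::'v))"
    by (intro bilinear_map_pure \<pi>_linear S_alg_subset_weyl assms)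
  show "bilinear_map (\<lambda>z y. \<pi> (mon s) z \<otimes>\<^sub>t \<rho> (outer s (field_coeff X s)) y)" for s
    by (intro bilinear_map_pure \<pi>_linear \<rho>_linear weyl_algebra.intros)
      (simp add: outer_in_sl pairing_field_coeff[OF assms])
qed

private lemma F_linear: "X \<in> S_alg \<Longrightarrow> clinear (F_action \<pi> \<rho> X)"
  unfolding F_action_def by (rule clinear_tensor_lift[OF F_bilinear])

private lemma F_pure:
  assumes "X \<in> S_alg" "finite S" "{s. field_coeff X s \<noteq> 0} \<subseteq> S"
  shows "F_action \<pi> \<rho> X (z \<otimes>\<^sub>t y) = \<pi> X z \<otimes>\<^sub>t y +
    (\<Sum>s\<in>S. \<pi> (mon s) z \<otimes>\<^sub>t \<rho> (outer s (field_coeff X s)) y)"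
  unfolding F_action_def tensor_lift_pure[OF F_bilinear[OF assms(1)]]
  by (rule arg_cong2[where f = "(+)", OF refl], rule sum.mono_neutral_left)
    (use assms(2,3) in \<open>auto simp: outer_zero \<rho>_zero pure_tensor_zero\<close>)

lemma F_action_D:
  assumes "pairing u r = 0"
  shows "F_action \<pi> \<rho> (D_op u r) (z \<otimes>\<^sub>t y)
    = \<pi> (D_op u r) z \<otimes>\<^sub>t y + \<pi> (\<lambda>g. xpow r * g) z \<otimes>\<^sub>t \<rho> (outer r u) y"
proof -
  have "{s. field_coeff (D_op u r) s \<noteq> 0} \<subseteq> {r}" by (auto simp: field_coeff_D_op)
  from F_pure[OF D_op_in_S_alg[OF assms] _ this] show ?thesis by (simp add: field_coeff_D_op)
qed

private lemma F_add:
  assumes "X \<in> S_alg" "Y \<in> S_alg"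
  shows "F_action \<pi> \<rho> (X + Y) t = F_action \<pi> \<rho> X t + F_action \<pi> \<rho> Y t"
proof (rule tensor_ext[of "F_action \<pi> \<rho> (X + Y)"
      "\<lambda>t. F_action \<pi> \<rho> X t + F_action \<pi> \<rho> Y t"])
  show "clinear (F_action \<pi> \<rho> (X + Y))" "clinear (\<lambda>t. F_action \<pi> \<rho> X t + F_action \<pi> \<rho> Y t)"
    by (rule F_linear[OF S_alg_add[OF assms]]
        clinear_plus[OF F_linear[OF assms(1)] F_linear[OF assms(2)]])+
  fix z y
  let ?S = "{s. field_coeff X s \<noteq> 0} \<union> {s. field_coeff Y s \<noteq> 0}"
  have S: "finite ?S" by (simp add: finite_field_coeff)
  have sub: "{s. field_coeff (X + Y) s \<noteq> 0} \<subseteq> ?S" by (auto simp: field_coeff_add)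
  show "F_action \<pi> \<rho> (X + Y) (z \<otimes>\<^sub>t y)
      = F_action \<pi> \<rho> X (z \<otimes>\<^sub>t y) + F_action \<pi> \<rho> Y (z \<otimes>\<^sub>t y)"
    using F_pure[OF S_alg_add[OF assms] S sub] F_pure[OF assms(1) S Un_upper1]
      F_pure[OF assms(2) S Un_upper2]
    by (simp add: \<pi>_add S_alg_subset_weyl assms pure_tensor_linear field_coeff_add outer_add
        \<rho>_add outer_in_sl pairing_field_coeff sum.distrib)
qed

private lemma F_scale:
  assumes "X \<in> S_alg"
  shows "F_action \<pi> \<rho> (c *\<^sub>C X) t = c *\<^sub>C F_action \<pi> \<rho> X t"
proof (rule tensor_ext[of "F_action \<pi> \<rho> (c *\<^sub>C X)" "\<lambda>t. c *\<^sub>C F_action \<pi> \<rho> X t"])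
  show "clinear (F_action \<pi> \<rho> (c *\<^sub>C X))" "clinear (\<lambda>t. c *\<^sub>C F_action \<pi> \<rho> X t)"
    by (rule F_linear[OF S_alg_scale[OF assms]] clinear_scaled[OF F_linear[OF assms]])+
  fix z y
  let ?S = "{s. field_coeff X s \<noteq> 0}"
  have sub: "{s. field_coeff (c *\<^sub>C X) s \<noteq> 0} \<subseteq> ?S"
    by (rule Collect_mono) (metis field_coeff_scale complex_vector.scale_zero_right)
  show "F_action \<pi> \<rho> (c *\<^sub>C X) (z \<otimes>\<^sub>t y) = c *\<^sub>C F_action \<pi> \<rho> X (z \<otimes>\<^sub>t y)"
    unfolding F_pure[OF S_alg_scale[OF assms] finite_field_coeff sub]
      F_pure[OF assms finite_field_coeff subset_refl]
    by (simp add: \<pi>_scale S_alg_subset_weyl assms pure_tensor_linear field_coeff_scale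
        outer_scale \<rho>_scale outer_in_sl pairing_field_coeff complex_vector.scale_sum_right
        complex_vector.scale_right_distrib del: complex_vector.scale_scale)
qed

private lemma F_zero: "F_action \<pi> \<rho> 0 t = 0"
  using F_scale[OF S_alg_zero, of 0 t] by simp

private lemma F_bracket_D:
  assumes u: "pairing u r = 0" and v: "pairing v s = 0"
  shows "F_action \<pi> \<rho> (op_bracket (D_op u r) (D_op v s)) t
    = F_action \<pi> \<rho> (D_op u r) (F_action \<pi> \<rho> (D_op v s) t)
      - F_action \<pi> \<rho> (D_op v s) (F_action \<pi> \<rho> (D_op u r) t)"
proof (rule tensor_ext[of "F_action \<pi> \<rho> (op_bracket (D_op u r) (D_op v s))"
      "\<lambda>t. F_action \<pi> \<rho> (D_op u r) (F_action \<pi> \<rho> (D_op v s) t)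
        - F_action \<pi> \<rho> (D_op v s) (F_action \<pi> \<rho> (D_op u r) t)"])
  let ?w = "pairing u s *\<^sub>C v - pairing v r *\<^sub>C u"
  have w: "pairing ?w (r + s) = 0"
    using u v by (simp add: pairing_diff pairing_scale pairing_add_right mult.commute)
  note lin = F_linear[OF D_op_in_S_alg[OF u]] F_linear[OF D_op_in_S_alg[OF v]]
  show "clinear (F_action \<pi> \<rho> (op_bracket (D_op u r) (D_op v s)))"
    by (intro F_linear op_bracket_in_S_alg u v)
  show "clinear (\<lambda>t. F_action \<pi> \<rho> (D_op u r) (F_action \<pi> \<rho> (D_op v s) t)
      - F_action \<pi> \<rho> (D_op v s) (F_action \<pi> \<rho> (D_op u r) t))"
    by (rule clinear_minus[OF clinear_comp[OF lin] clinear_comp[OF lin(2,1)]])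
  fix z y
  have m: "mon q \<in> weyl_algebra" for q by (rule weyl_algebra.intros)
  have mm: "\<pi> (mon p) (\<pi> (mon q) z) = \<pi> (mon (p + q)) z" for p q
    by (simp add: \<pi>_comp[OF m m, symmetric] comp_def mult.assoc[symmetric] xpow_xpow)
  have Dm: "\<pi> (D_op u r) (\<pi> (mon s) z)
      = \<pi> (mon s) (\<pi> (D_op u r) z) + pairing u s *\<^sub>C \<pi> (mon (r + s)) z" for u r s
    by (simp add: \<pi>_comp[symmetric] D_op_comp_xpow \<pi>_add \<pi>_scale m D_op_in_weyl
        weyl_algebra.intros)
  have sl: "outer r u \<in> sl" "outer s v \<in> sl"
    using u v by (simp_all add: outer_in_sl)
  have sl_scale: "a *\<^sub>C A \<in> sl" if "A \<in> sl" for a and A :: "'n sqmat"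
    using that by (simp add: sl_def trace_def sum_distrib_left[symmetric])
  have sl': "A + B \<in> sl" "A - B \<in> sl" "mat_bracket A B \<in> sl"
    if "A \<in> sl" "B \<in> sl" for A B :: "'n sqmat"
    using that by (simp_all add: sl_def mat_bracket_def trace_add trace_sub trace_mul_sym[of A B])
  have \<rho>_diff: "\<rho> (A - B) y = \<rho> A y - \<rho> B y" if "A \<in> sl" "B \<in> sl" for A B
    using \<rho>_add[of "A - B" B y] that sl'(2) by (simp add: algebra_simps)
  have \<rho>w: "\<rho> (outer (r + s) ?w) y
      = pairing u s *\<^sub>C \<rho> (outer s v) y - pairing v r *\<^sub>C \<rho> (outer r u) y
        + (\<rho> (outer r u) (\<rho> (outer s v) y) - \<rho> (outer s v) (\<rho> (outer r u) y))"
    by (simp add: outer_bracket \<rho>_add \<rho>_diff \<rho>_scale \<rho>_bracket sl sl' sl_scale)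
  have "\<pi> (D_op u r) (\<pi> (D_op v s) z) = \<pi> (D_op u r \<circ> D_op v s) z"
    by (simp add: \<pi>_comp D_op_in_weyl)
  also have "D_op u r \<circ> D_op v s = D_op ?w (r + s) + (D_op v s \<circ> D_op u r)"
    by (simp add: op_bracket_D_op[symmetric] op_bracket_def)
  finally have \<pi>w: "\<pi> (D_op ?w (r + s)) z
      = \<pi> (D_op u r) (\<pi> (D_op v s) z) - \<pi> (D_op v s) (\<pi> (D_op u r) z)"
    unfolding \<pi>_add[OF D_op_in_weyl weyl_algebra.compose[OF D_op_in_weyl D_op_in_weyl]]
      \<pi>_comp[OF D_op_in_weyl D_op_in_weyl] by simp
  show "F_action \<pi> \<rho> (op_bracket (D_op u r) (D_op v s)) (z \<otimes>\<^sub>t y)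
    = F_action \<pi> \<rho> (D_op u r) (F_action \<pi> \<rho> (D_op v s) (z \<otimes>\<^sub>t y))
      - F_action \<pi> \<rho> (D_op v s) (F_action \<pi> \<rho> (D_op u r) (z \<otimes>\<^sub>t y))"
    unfolding op_bracket_D_op F_action_D[OF w] F_action_D[OF u] F_action_D[OF v]
      clinear_add[OF lin(1)] clinear_add[OF lin(2)] \<pi>w \<rho>w mm Dm
    by (simp add: pure_tensor_linear add.commute[of s r] algebra_simps)
qed

private lemma F_bracket_D_right:
  assumes u: "pairing u r = 0" and "Y \<in> S_alg"
  shows "op_bracket (D_op u r) Y \<in> S_alg \<and> F_action \<pi> \<rho> (op_bracket (D_op u r) Y) t
    = F_action \<pi> \<rho> (D_op u r) (F_action \<pi> \<rho> Y t)
      - F_action \<pi> \<rho> Y (F_action \<pi> \<rho> (D_op u r) t)"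
proof -
  note lin = F_linear[OF D_op_in_S_alg[OF u]]
  have D: "clinear (D_op u r)"
    by (auto simp: clinear_iff lookup_D_op lookup_add algebra_simps intro!: poly_mapping_eqI)
  show ?thesis
    using assms(2)
  proof (induction rule: S_alg_induct)
    case zero
    have "op_bracket (D_op u r) 0 = 0"
      by (simp add: op_bracket_def fun_eq_iff clinear_0[OF D])
    then show ?case by (simp add: F_zero S_alg_zero clinear_0[OF lin] del: zero_fun_apply)
  next
    case (step c v s Y)
    have eq: "op_bracket (D_op u r) (c *\<^sub>C D_op v s + Y)
        = c *\<^sub>C op_bracket (D_op u r) (D_op v s) + op_bracket (D_op u r) Y"
      by (simp add: op_bracket_def fun_eq_iff clinear_add[OF D] clinear_scale[OF D]
          complex_vector.scale_right_diff_distrib)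
    have mem: "op_bracket (D_op u r) (D_op v s) \<in> S_alg"
      by (rule op_bracket_in_S_alg[OF u step(1)])
    from step mem show ?case
      unfolding eq
      by (simp add: S_alg_add S_alg_scale F_add F_scale D_op_in_S_alg F_bracket_D[OF u step(1)]
          clinear_add[OF lin] clinear_scale[OF lin] complex_vector.scale_right_diff_distrib
          del: plus_fun_apply scaleC_fun_apply)
  qed
qed

private lemma S_alg_linear: "X \<in> S_alg \<Longrightarrow> clinear X"
proof (induction rule: S_alg_induct)
  case (step c u r Y)
  have "clinear (D_op u r)"
    by (auto simp: clinear_iff lookup_D_op lookup_add algebra_simps intro!: poly_mapping_eqI)
  from clinear_plus[OF clinear_scaled[OF this] step(3)] show ?case
    by (simp add: plus_fun_def scaleC_fun_def)
qed (simp add: clinear_iff)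

private lemma F_bracket:
  assumes "X \<in> S_alg" and Y: "Y \<in> S_alg"
  shows "op_bracket X Y \<in> S_alg \<and> F_action \<pi> \<rho> (op_bracket X Y) t
    = F_action \<pi> \<rho> X (F_action \<pi> \<rho> Y t) - F_action \<pi> \<rho> Y (F_action \<pi> \<rho> X t)"
  using assms(1)
proof (induction rule: S_alg_induct)
  case zero
  have "op_bracket 0 Y = 0"
    by (simp add: op_bracket_def fun_eq_iff clinear_0[OF S_alg_linear[OF Y]])
  then show ?case by (simp add: F_zero S_alg_zero clinear_0[OF F_linear[OF Y]] del: zero_fun_apply)
next
  case (step c u r X)
  have eq: "op_bracket (c *\<^sub>C D_op u r + X) Y = c *\<^sub>C op_bracket (D_op u r) Y + op_bracket X Y"
    by (simp add: op_bracket_def fun_eq_iff clinear_add[OF S_alg_linear[OF Y]]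
        clinear_scale[OF S_alg_linear[OF Y]] complex_vector.scale_right_diff_distrib)
  from step F_bracket_D_right[OF step(1) Y, of t] show ?case
    unfolding eq
    by (simp add: S_alg_add S_alg_scale F_add F_scale D_op_in_S_alg
        clinear_add[OF F_linear[OF Y]] clinear_scale[OF F_linear[OF Y]]
        complex_vector.scale_right_diff_distrib del: plus_fun_apply scaleC_fun_apply)
qed

lemma lie_module_F_action: "lie_module S_alg op_bracket (F_action \<pi> \<rho>)"
  using F_linear F_add F_scale F_bracket by (simp add: lie_module_def linear_action_def)

end

end

theory Submission
  imports
    Defs
    "HOL-Computational_Algebra.Fundamental_Theorem_Algebra"
    "HOL-Analysis.Continuum_Not_Denumerable"
begin

text \<open>
  Let \<open>M\<close> be a nonzero \<open>\<S>\<^sub>n\<close>-submodule of \<open>P \<otimes> V\<close>. The idea is to find inside \<open>M\<close> a nonzero subspace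
  that is stable under the two commuting algebras \<open>\<K>\<^sub>n\<close> (acting on \<open>P\<close>) and \<open>sl\<^sub>n\<close> (acting on \<open>V\<close>),
  and to use that \<open>P \<otimes> V\<close> is irreducible under both of them together.

  The action of \<open>D(u, r)\<close> is \<open>x\<^sup>r(\<partial>\<^sub>u + r u\<^sup>T)\<close>. A product \<open>D(\<alpha> + k u, r - k m) D(v, k m)\<close>, with
  \<open>u\<close>, \<open>v\<close> orthogonal to \<open>m\<close> and \<open>\<alpha>\<close> chosen such that the first factor has divergence zero for
  every \<open>k\<close>, equals \<open>x\<^sup>r\<close> times a polynomial in \<open>k\<close>, and it preserves \<open>M\<close> for all natural numbers \<open>k\<close>.
  So each coefficient preserves \<open>M\<close> as well, and the cubic one is, up to sign,
  \<open>x\<^sup>r (m u\<^sup>T)(m v\<^sup>T)\<close> (\<open>square_action_in_submodule\<close>). In other words, \<open>(m u\<^sup>T)(m v\<^sup>T)\<close> maps \<open>M\<close> into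
  the largest \<open>A\<^sub>n\<close>-stable subspace \<open>M'\<close> of \<open>M\<close>, called \<open>mult_core M\<close> below. On \<open>M'\<close> the factor \<open>x\<^sup>r\<close>
  can be removed from \<open>D(u, r)\<close>; \<open>r = 0\<close> gives stability under every \<open>\<partial>\<^sub>u\<close> and then
  subtraction gives stability under every \<open>r u\<^sup>T\<close>, so \<open>M'\<close> is stable under \<open>\<K>\<^sub>n\<close> and \<open>sl\<^sub>n\<close>.

  It remains to exclude \<open>M' = 0\<close>. The vectors of \<open>V\<close> killed by all \<open>(m u\<^sup>T)(m v\<^sup>T)\<close> form a submodule
  (\<open>submodule_square_kernel\<close>). If it is \<open>0\<close>, then these operators cannot kill a nonzero
  element of \<open>P \<otimes> V\<close>, as one sees from its coordinates with respect to a basis of \<open>P\<close>, and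
  \<open>M' \<noteq> 0\<close>. If it is \<open>V\<close>, then \<open>E\<^sub>i\<^sub>j\<^sup>2 = 0\<close> on \<open>V\<close> for all \<open>i \<noteq> j\<close>. Then every coroot is diagonalisable
  with eigenvalues in \<open>{-1, 0, 1}\<close>, so there is a highest weight vector, \<open>V\<close> is finite-dimensional
  and the highest weight is some \<open>\<delta>\<^sub>k\<close> (\<open>fundamental_module\<close>), which the hypothesis forbids.

  Irreducibility of \<open>P \<otimes> V\<close> under \<open>\<K>\<^sub>n\<close> and \<open>sl\<^sub>n\<close> (\<open>irreducible_tensor_product\<close>) rests on Schur's
  lemma for the possibly infinite-dimensional \<open>V\<close>; it holds because \<open>V\<close> has countable dimension
  while \<open>\<complex>\<close> is uncountable (\<open>schur_countable_dimension\<close>).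
\<close>

section \<open>Polynomials with values in a subspace\<close>

text \<open>
  Over an infinite field a polynomial with vector coefficients that takes all its values in a
  subspace has its coefficients there. Replacing \<open>p(k)\<close> by \<open>2\<^sup>d p(k) - p(2 k)\<close>, where \<open>d\<close> is the degree, kills
  the leading term and multiplies each other coefficient by a nonzero number.
\<close>

lemma poly_coeffs_in_subspace:
  fixes c :: "nat \<Rightarrow> 'a::complex_vector"
  assumes M: "csubspace M"
    and "\<And>k::nat. (\<Sum>i\<le>d. of_nat k ^ i *\<^sub>C c i) \<in> M" and "i \<le> d"
  shows "c i \<in> M"
  using assms(2,3)
proof (induction d arbitrary: c i)
  case 0
  then show ?case by (simp add: scaleC_one)
next
  case (Suc d)
  let ?p = "\<lambda>k::nat. \<Sum>i\<le>Suc d. of_nat k ^ i *\<^sub>C c i"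
  let ?a = "\<lambda>i. (2 ^ Suc d - 2 ^ i :: complex)"
  have "(\<Sum>i\<le>d. of_nat k ^ i *\<^sub>C ?a i *\<^sub>C c i) \<in> M" for k
  proof -
    have "2 ^ Suc d *\<^sub>C ?p k - ?p (2 * k) = (\<Sum>i\<le>Suc d. of_nat k ^ i *\<^sub>C ?a i *\<^sub>C c i)"
      by (simp only: complex_vector.scale_sum_right sum_subtractf[symmetric]
          complex_vector.scale_scale complex_vector.scale_left_diff_distrib[symmetric]
          of_nat_mult power_mult_distrib of_nat_numeral) (simp add: algebra_simps)
    also have "\<dots> = (\<Sum>i\<le>d. of_nat k ^ i *\<^sub>C ?a i *\<^sub>C c i)" by simp
    finally have eq: "2 ^ Suc d *\<^sub>C ?p k - ?p (2 * k) = (\<Sum>i\<le>d. of_nat k ^ i *\<^sub>C ?a i *\<^sub>C c i)" .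
    show ?thesis
      unfolding eq[symmetric]
      by (intro complex_vector.subspace_diff[OF M] complex_vector.subspace_scale[OF M] Suc.prems(1))
  qed
  note IH = Suc.IH[of "\<lambda>i. ?a i *\<^sub>C c i", OF this]
  have low: "c j \<in> M" if "j \<le> d" for j
  proof -
    have "(2::nat) ^ j < 2 ^ Suc d" using that by (intro power_strict_increasing) auto
    then have "of_nat (2 ^ j) \<noteq> (of_nat (2 ^ Suc d) :: complex)" by (simp only: of_nat_eq_iff)
    then have "?a j \<noteq> 0" by simp
    then have "c j = inverse (?a j) *\<^sub>C ?a j *\<^sub>C c j"
      unfolding scaleC_scaleC by (subst left_inverse) (assumption, simp only: scaleC_one)
    also have "\<dots> \<in> M" by (rule complex_vector.subspace_scale[OF M IH[OF that]])
    finally show ?thesis .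
  qed
  have "c (Suc d) = ?p 1 - (\<Sum>i\<le>d. c i)" by (simp add: scaleC_one)
  also have "\<dots> \<in> M"
    by (intro complex_vector.subspace_diff[OF M] Suc.prems(1) complex_vector.subspace_sum[OF M] low) simp
  finally show ?case using low Suc.prems(2) by (metis le_Suc_eq)
qed

section \<open>Schur's lemma in countable dimension\<close>

definition poly_act :: "('a::complex_vector \<Rightarrow> 'a) \<Rightarrow> complex poly \<Rightarrow> 'a \<Rightarrow> 'a"
  where "poly_act \<phi> p v = (\<Sum>i\<le>degree p. coeff p i *\<^sub>C (\<phi> ^^ i) v)"

lemma poly_act_superset:
  "degree p \<le> d \<Longrightarrow> poly_act \<phi> p v = (\<Sum>i\<le>d. coeff p i *\<^sub>C (\<phi> ^^ i) v)"
  unfolding poly_act_def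
  by (intro sum.mono_neutral_left) (auto simp: coeff_eq_0)

lemma poly_act_add: "poly_act \<phi> (p + q) v = poly_act \<phi> p v + poly_act \<phi> q v"
  using degree_add_le_max[of p q]
  by (simp add: poly_act_superset[of _ "max (degree p) (degree q)"] scaleC_add_left sum.distrib)

lemma poly_act_smult: "poly_act \<phi> (smult c p) v = c *\<^sub>C poly_act \<phi> p v"
  by (subst poly_act_superset[OF degree_smult_le])
    (simp add: poly_act_def complex_vector.scale_sum_right)

lemma poly_act_0: "poly_act \<phi> 0 v = 0"
  by (simp add: poly_act_def)

lemma poly_act_sum: "poly_act \<phi> (\<Sum>i\<in>S. p i) v = (\<Sum>i\<in>S. poly_act \<phi> (p i) v)"
  by (induction S rule: infinite_finite_induct) (simp_all add: poly_act_add poly_act_0)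

lemma poly_act_pCons:
  assumes "clinear \<phi>"
  shows "poly_act \<phi> (pCons a p) v = a *\<^sub>C v + \<phi> (poly_act \<phi> p v)"
proof -
  have "poly_act \<phi> (pCons a p) v = (\<Sum>i\<le>Suc (degree p). coeff (pCons a p) i *\<^sub>C (\<phi> ^^ i) v)"
    by (rule poly_act_superset) (rule degree_pCons_le)
  also have "\<dots> = a *\<^sub>C v + (\<Sum>i\<le>degree p. coeff p i *\<^sub>C \<phi> ((\<phi> ^^ i) v))"
    by (subst sum.atMost_Suc_shift) simp
  finally show ?thesis
    by (simp add: poly_act_def clinear_sum[OF assms] clinear_scale[OF assms])
qed

lemma clinear_poly_act:
  assumes "clinear \<phi>"
  shows "clinear (poly_act \<phi> p)"
proof (induction p)
  case (pCons a p)
  have "clinear (\<lambda>v. a *\<^sub>C v + \<phi> (poly_act \<phi> p v))"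
    using clinear_plus[OF clinear_scaled clinear_comp[OF assms pCons.IH], of "\<lambda>v. v" a]
    by (simp add: clinear_iff)
  moreover have "poly_act \<phi> (pCons a p) = (\<lambda>v. a *\<^sub>C v + \<phi> (poly_act \<phi> p v))"
    by (rule ext) (rule poly_act_pCons[OF assms])
  ultimately show ?case by simp
qed (simp add: clinear_iff poly_act_0)

lemma poly_act_mult:
  assumes "clinear \<phi>"
  shows "poly_act \<phi> (p * q) v = poly_act \<phi> p (poly_act \<phi> q v)"
  by (induction p) (simp_all add: poly_act_0 poly_act_pCons[OF assms] poly_act_add poly_act_smult)

lemma poly_act_linear_factor:
  "clinear \<phi> \<Longrightarrow> poly_act \<phi> [:- a, 1:] v = \<phi> v - a *\<^sub>C v"
  by (simp add: poly_act_pCons poly_act_0 scaleC_one clinear_0)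

text \<open>
  A nonzero polynomial in an operator without eigenvalues is injective, since it is a product of
  injective linear factors.
\<close>

lemma poly_act_nonzero:
  assumes \<phi>: "clinear \<phi>" and inj: "\<And>a v. \<phi> v = a *\<^sub>C v \<Longrightarrow> v = 0"
    and "p \<noteq> 0" "v \<noteq> 0"
  shows "poly_act \<phi> p v \<noteq> 0"
  using \<open>p \<noteq> 0\<close>
proof (induction "degree p" arbitrary: p)
  case 0
  then obtain c where "p = [:c:]" "c \<noteq> 0" by (metis degree_eq_zeroE pCons_0_0)
  with \<open>v \<noteq> 0\<close> show ?case by (simp add: poly_act_pCons[OF \<phi>] poly_act_0 clinear_0[OF \<phi>])
next
  case (Suc d)
  then have "\<not> constant (poly p)" by (simp add: constant_degree)
  then obtain a where "poly p a = 0" using fundamental_theorem_of_algebra by blast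
  then obtain q where p: "p = [:- a, 1:] * q" using poly_eq_0_iff_dvd dvd_def by metis
  with Suc have q: "q \<noteq> 0" by auto
  then have "degree p = Suc (degree q)" unfolding p by (subst degree_mult_eq) simp_all
  with Suc q have "poly_act \<phi> q v \<noteq> 0" by simp
  then show ?case
    unfolding p poly_act_mult[OF \<phi>] poly_act_linear_factor[OF \<phi>] using inj by force
qed

text \<open>
  Think of \<open>w a\<close> as \<open>(\<phi> - a)\<^sup>-\<^sup>1 v\<close>. Clearing denominators turns a linear relation between these vectors
  into \<open>p(\<phi>) v = 0\<close>, where \<open>p\<close> is the numerator of \<open>\<Sum>\<^sub>a c\<^sub>a / (X - a)\<close>. So \<open>p = 0\<close>, and its value at \<open>b\<close> is
  \<open>c\<^sub>b\<close> times a nonzero number.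
\<close>

lemma independent_resolvents:
  assumes \<phi>: "clinear \<phi>" and inj: "\<And>a v. \<phi> v = a *\<^sub>C v \<Longrightarrow> v = 0"
    and w: "\<And>a. \<phi> (w a) - a *\<^sub>C w a = v" and "v \<noteq> 0"
    and S: "finite S" and zero: "(\<Sum>a\<in>S. c a *\<^sub>C w a) = 0" and "b \<in> S"
  shows "c b = 0"
proof -
  let ?q = "\<lambda>T. \<Prod>a\<in>T. [:- a, 1:]"
  let ?p = "\<Sum>a\<in>S. smult (c a) (?q (S - {a}))"
  note lin = clinear_poly_act[OF \<phi>]
  have step: "poly_act \<phi> (?q S) (w a) = poly_act \<phi> (?q (S - {a})) v" if "a \<in> S" for a
    using poly_act_mult[OF \<phi>, of "?q (S - {a})" "[:- a, 1:]" "w a"] that S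
    by (simp only: poly_act_linear_factor[OF \<phi>] w prod.remove[OF S that] mult.commute)
  have "poly_act \<phi> ?p v = poly_act \<phi> (?q S) (\<Sum>a\<in>S. c a *\<^sub>C w a)"
    by (simp add: clinear_sum[OF lin] clinear_scale[OF lin] poly_act_sum poly_act_smult step)
  also have "\<dots> = 0" unfolding zero by (rule clinear_0[OF lin])
  finally have "?p = 0" using poly_act_nonzero[OF \<phi> _ _ \<open>v \<noteq> 0\<close>] inj by blast
  moreover have "poly ?p b = c b * (\<Prod>a\<in>S - {b}. b - a)"
  proof -
    have "poly (?q (S - {a})) b = 0" if "a \<in> S" "a \<noteq> b" for a
      using that \<open>b \<in> S\<close> S by (auto simp: poly_prod intro!: prod_zero bexI[of _ b])
    then have "poly ?p b = (\<Sum>a\<in>S. if a = b then c b * poly (?q (S - {b})) b else 0)"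
      by (simp add: poly_sum) (intro sum.cong, auto)
    then show ?thesis using S \<open>b \<in> S\<close> by (simp add: poly_prod)
  qed
  ultimately show ?thesis using S by (simp add: prod_zero_iff)
qed

text \<open>
  Dixmier's argument. If \<open>\<phi>\<close> is not a scalar, then every \<open>\<phi> - a\<close> is bijective, because its kernel and its
  range are submodules; the vectors \<open>(\<phi> - a)\<^sup>-\<^sup>1 v\<close> are then uncountably many independent vectors in a
  space with a countable spanning set.
\<close>

lemma schur_countable_dimension:
  fixes \<rho> :: "'l \<Rightarrow> 'v::complex_vector \<Rightarrow> 'v" and B :: "'v set"
  assumes L: "irreducible_action L \<rho>" and lin: "\<And>X. X \<in> L \<Longrightarrow> clinear (\<rho> X)"
    and B: "countable B" "cspan B = UNIV"
    and \<phi>: "clinear \<phi>" and comm: "\<And>X v. X \<in> L \<Longrightarrow> \<phi> (\<rho> X v) = \<rho> X (\<phi> v)"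
  shows "\<exists>c. \<forall>v. \<phi> v = c *\<^sub>C v"
proof (rule ccontr)
  assume notscal: "\<nexists>c. \<forall>v. \<phi> v = c *\<^sub>C v"
  define \<psi> where "\<psi> a v = \<phi> v - a *\<^sub>C v" for a v
  have \<psi>: "clinear (\<psi> a)" for a
    unfolding \<psi>_def by (intro clinear_minus \<phi> clinear_scaled) (simp add: clinear_iff)
  have \<psi>_comm: "\<psi> a (\<rho> X v) = \<rho> X (\<psi> a v)" if "X \<in> L" for X a v
    by (simp add: \<psi>_def comm that clinear_diff[OF lin] clinear_scale[OF lin])
  have irr: "M = {0} \<or> M = UNIV" if "submodule L \<rho> M" for M
    using L that by (simp add: irreducible_action_def)
  obtain v0 :: 'v where v0: "v0 \<noteq> 0" using L by (auto simp: irreducible_action_def)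
  have ker: "v = 0" if "\<phi> v = a *\<^sub>C v" for v a
  proof -
    have "submodule L \<rho> {v. \<psi> a v = 0}"
      unfolding submodule_def
      by (auto intro!: complex_vector.subspaceI simp: clinear_0[OF \<psi>] clinear_add[OF \<psi>]
          clinear_scale[OF \<psi>] \<psi>_comm clinear_0[OF lin])
    from irr[OF this] have "{v. \<psi> a v = 0} = {0}"
    proof
      assume "{v. \<psi> a v = 0} = UNIV"
      then have "\<forall>v. \<phi> v = a *\<^sub>C v" by (auto simp: \<psi>_def)
      with notscal show ?thesis by blast
    qed
    with that show ?thesis by (auto simp: \<psi>_def)
  qed
  have "v0 \<in> range (\<psi> a)" for a
  proof -
    have "submodule L \<rho> (range (\<psi> a))"
      unfolding submodule_def
      by (auto intro!: complex_vector.subspaceI simp: \<psi>_comm[symmetric])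
        (metis clinear_0[OF \<psi>] rangeI, metis clinear_add[OF \<psi>] rangeI, metis clinear_scale[OF \<psi>] rangeI)
    from irr[OF this] show ?thesis
    proof
      assume "range (\<psi> a) = {0}"
      then have "\<psi> a v0 = 0" by blast
      then have "\<phi> v0 = a *\<^sub>C v0" by (simp add: \<psi>_def)
      then show ?thesis using v0 ker by blast
    qed simp
  qed
  then have "\<forall>a. \<exists>w. \<phi> w - a *\<^sub>C w = v0" by (force simp: \<psi>_def)
  then obtain w where w: "\<And>a. \<phi> (w a) - a *\<^sub>C w a = v0" by metis
  have inj: "inj w"
  proof
    fix a b assume "w a = w b"
    then have "(a - b) *\<^sub>C w a = 0"
      using w[of a] w[of b] by (simp add: complex_vector.scale_left_diff_distrib algebra_simps)
    moreover have "w a \<noteq> 0" using w[of a] v0 by (auto simp: clinear_0[OF \<phi>])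
    ultimately show "a = b" by simp
  qed
  have indep: "complex_vector.independent (range w)"
    unfolding complex_vector.independent_explicit_module
  proof (intro allI impI)
    fix T u v assume T: "finite T" "T \<subseteq> range w" "(\<Sum>v\<in>T. u v *\<^sub>C v) = 0" "v \<in> T"
    then obtain S where S: "T = w ` S" "finite S" by (metis finite_subset_image)
    have "(\<Sum>a\<in>S. u (w a) *\<^sub>C w a) = 0"
      using T(3) unfolding S(1) by (subst (asm) sum.reindex) (auto intro: inj_on_subset[OF inj])
    moreover obtain b where "b \<in> S" "v = w b" using T(4) S(1) by auto
    ultimately show "u v = 0"
      using independent_resolvents[OF \<phi> _ w v0 S(2), where c = "\<lambda>a. u (w a)" and b = b] ker by blast
  qed
  \<comment> \<open>Only finitely many \<open>w a\<close> fit into the span of a finite set, and \<open>B\<close> has only countably many finite subsets.\<close>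
  have "finite {a. w a \<in> cspan F}" if "finite F" for F
  proof -
    have "complex_vector.independent (w ` {a. w a \<in> cspan F})"
      by (rule complex_vector.independent_mono[OF indep]) auto
    then have "finite (w ` {a. w a \<in> cspan F})"
      using complex_vector.independent_span_bound[OF that] by blast
    then show ?thesis by (rule finite_imageD) (rule inj_on_subset[OF inj], simp)
  qed
  then have "countable (\<Union>F\<in>{F. finite F \<and> F \<subseteq> B}. {a. w a \<in> cspan F})"
    by (intro countable_UN countable_Collect_finite_subset B) (auto simp: countable_finite)
  moreover have "(\<Union>F\<in>{F. finite F \<and> F \<subseteq> B}. {a. w a \<in> cspan F}) = UNIV"
  proof -
    have "\<exists>F. finite F \<and> F \<subseteq> B \<and> x \<in> cspan F" for x
    proof -
      have "x \<in> cspan B" using B by simp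
      then obtain F c where F: "finite F" "F \<subseteq> B" "x = (\<Sum>a\<in>F. c a *\<^sub>C a)"
        unfolding complex_vector.span_explicit by blast
      then have "x \<in> cspan F"
        by (auto intro: complex_vector.span_sum complex_vector.span_scale complex_vector.span_base)
      with F show ?thesis by blast
    qed
    then show ?thesis by blast
  qed
  ultimately have "countable (UNIV :: complex set)" by simp
  moreover have "uncountable (UNIV :: complex set)"
    by (rule uncountable_UNIV_complex)
  ultimately show False by simp
qed

section \<open>Irreducibility of a tensor product under two commuting actions\<close>

definition tensor_left :: "('a::complex_vector \<Rightarrow> 'a) \<Rightarrow> ('a, 'b::complex_vector) tensor \<Rightarrow> ('a, 'b) tensor"
  where "tensor_left f = tensor_lift (\<lambda>x y. f x \<otimes>\<^sub>t y)"

definition tensor_right :: "('b::complex_vector \<Rightarrow> 'b) \<Rightarrow> ('a::complex_vector, 'b) tensor \<Rightarrow> ('a, 'b) tensor"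
  where "tensor_right g = tensor_lift (\<lambda>x y. x \<otimes>\<^sub>t g y)"

lemma clinear_id: "clinear (\<lambda>x. x)"
  by (simp add: clinear_iff)

lemma clinear_compose: "clinear f \<Longrightarrow> clinear g \<Longrightarrow> clinear (\<lambda>x. f (g x))"
  by (simp add: clinear_iff)

lemma
  assumes "clinear f"
  shows clinear_tensor_left: "clinear (tensor_left f)"
    and tensor_left_pure: "tensor_left f (x \<otimes>\<^sub>t y) = f x \<otimes>\<^sub>t y"
  unfolding tensor_left_def
  by (rule clinear_tensor_lift tensor_lift_pure bilinear_map_pure assms clinear_id)+

lemma
  assumes "clinear g"
  shows clinear_tensor_right: "clinear (tensor_right g)"
    and tensor_right_pure: "tensor_right g (x \<otimes>\<^sub>t y) = x \<otimes>\<^sub>t g y"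
  unfolding tensor_right_def
  by (rule clinear_tensor_lift tensor_lift_pure bilinear_map_pure assms clinear_id)+

text \<open>
  The component \<open>y\<^sub>b\<close> in \<open>t = \<Sum>\<^sub>b b \<otimes> y\<^sub>b\<close>, where \<open>b\<close> runs through the basis \<open>B\<close> of the first factor. As no basis of the
  second factor is involved, the coordinates commute with every action on that factor.
\<close>

definition coordinate :: "'a::complex_vector set \<Rightarrow> 'a \<Rightarrow> ('a, 'b::complex_vector) tensor \<Rightarrow> 'b"
  where "coordinate B b = tensor_lift (\<lambda>x y. complex_vector.representation B x b *\<^sub>C y)"

context
  fixes B :: "'a::complex_vector set"
  assumes B: "complex_vector.independent B" "cspan B = UNIV"
begin

lemma bilinear_coordinate: "bilinear_map (\<lambda>x (y::'b::complex_vector). complex_vector.representation B x b *\<^sub>C y)"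
  using B by (simp add: bilinear_map_def clinear_iff complex_vector.representation_add
      complex_vector.representation_scale scaleC_add_left scaleC_add_right mult.commute)

lemma clinear_coordinate: "clinear (coordinate B b)"
  unfolding coordinate_def by (rule clinear_tensor_lift[OF bilinear_coordinate])

lemma coordinate_pure: "coordinate B b (x \<otimes>\<^sub>t y) = complex_vector.representation B x b *\<^sub>C y"
  unfolding coordinate_def by (rule tensor_lift_pure[OF bilinear_coordinate])

lemma coordinate_expansion:
  shows "finite {b. coordinate B b t \<noteq> 0}"
    and "t = (\<Sum>b | coordinate B b t \<noteq> 0. b \<otimes>\<^sub>t coordinate B b t)"
proof -
  have "\<exists>S. finite S \<and> (\<forall>b. b \<notin> S \<longrightarrow> coordinate B b t = 0) \<and> t = (\<Sum>b\<in>S. b \<otimes>\<^sub>t coordinate B b t)"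
    using tensor_span[of t]
  proof (induction rule: complex_vector.span_induct_alt)
    case base
    show ?case by (rule exI[of _ "{}"]) (simp add: clinear_0[OF clinear_coordinate])
  next
    case (step c s t)
    then obtain x y where s: "s = x \<otimes>\<^sub>t y" by blast
    let ?r = "complex_vector.representation B x"
    let ?R = "{b. ?r b \<noteq> 0}"
    obtain S where S: "finite S" "\<And>b. b \<notin> S \<Longrightarrow> coordinate B b t = 0"
      "t = (\<Sum>b\<in>S. b \<otimes>\<^sub>t coordinate B b t)" using step by blast
    have R: "finite ?R" by (rule complex_vector.finite_representation)
    have "x = (\<Sum>b\<in>?R. ?r b *\<^sub>C b)"
      using complex_vector.sum_nonzero_representation_eq[OF B(1), of x] B(2) by simp
    then have "s = (\<Sum>b\<in>?R. b \<otimes>\<^sub>t ?r b *\<^sub>C y)"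
      unfolding s by (metis (no_types, lifting) clinear_sum[OF clinear_pure_tensor(2)] pure_tensor_linear(5,6) sum.cong)
    also have "\<dots> = (\<Sum>b\<in>?R \<union> S. b \<otimes>\<^sub>t coordinate B b s)"
      unfolding s coordinate_pure
      by (rule sum.mono_neutral_left) (auto simp: R S(1) pure_tensor_zero)
    finally have s': "s = (\<Sum>b\<in>?R \<union> S. b \<otimes>\<^sub>t coordinate B b s)" .
    have "t = (\<Sum>b\<in>?R \<union> S. b \<otimes>\<^sub>t coordinate B b t)"
      by (subst S(3), rule sum.mono_neutral_left) (auto simp: R S(1,2) pure_tensor_zero)
    with s' have "c *\<^sub>C s + t = c *\<^sub>C (\<Sum>b\<in>?R \<union> S. b \<otimes>\<^sub>t coordinate B b s)
        + (\<Sum>b\<in>?R \<union> S. b \<otimes>\<^sub>t coordinate B b t)" by metis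
    also have "\<dots> = (\<Sum>b\<in>?R \<union> S. b \<otimes>\<^sub>t coordinate B b (c *\<^sub>C s + t))"
      by (simp only: clinear_add[OF clinear_coordinate] clinear_scale[OF clinear_coordinate]
          pure_tensor_linear sum.distrib complex_vector.scale_sum_right)
    finally have "c *\<^sub>C s + t = (\<Sum>b\<in>?R \<union> S. b \<otimes>\<^sub>t coordinate B b (c *\<^sub>C s + t))" .
    moreover have "coordinate B b (c *\<^sub>C s + t) = 0" if "b \<notin> ?R \<union> S" for b
      using that S(2)[of b]
      by (simp add: clinear_add[OF clinear_coordinate] clinear_scale[OF clinear_coordinate] s coordinate_pure)
    moreover have "finite (?R \<union> S)" using R S(1) by simp
    ultimately show ?case by blast
  qed
  then obtain S where S: "finite S" "\<And>b. b \<notin> S \<Longrightarrow> coordinate B b t = 0"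
    "t = (\<Sum>b\<in>S. b \<otimes>\<^sub>t coordinate B b t)" by blast
  then have sub: "{b. coordinate B b t \<noteq> 0} \<subseteq> S" by blast
  then show "finite {b. coordinate B b t \<noteq> 0}" using S(1) finite_subset by blast
  have "(\<Sum>b | coordinate B b t \<noteq> 0. b \<otimes>\<^sub>t coordinate B b t) = (\<Sum>b\<in>S. b \<otimes>\<^sub>t coordinate B b t)"
    by (rule sum.mono_neutral_left) (use S(1) sub in \<open>auto simp: pure_tensor_zero\<close>)
  with S(3) show "t = (\<Sum>b | coordinate B b t \<noteq> 0. b \<otimes>\<^sub>t coordinate B b t)" by simp
qed

lemma coordinates_eq_0: "(\<And>b. coordinate B b t = 0) \<Longrightarrow> t = 0"
  using coordinate_expansion(2)[of t] by simp

lemma coordinate_tensor_right: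
  "clinear g \<Longrightarrow> coordinate B b (tensor_right g t) = g (coordinate B b t)"
  by (rule tensor_ext[where t = t])
    (simp_all add: clinear_compose[OF clinear_coordinate clinear_tensor_right]
      clinear_compose[OF _ clinear_coordinate] tensor_right_pure coordinate_pure clinear_scale)

end

lemma basis_obtain:
  obtains B :: "'a::complex_vector set" where "complex_vector.independent B" "cspan B = UNIV"
  using complex_vector.basis_exists[of "UNIV :: 'a set"] by (metis top.extremum_uniqueI)

text \<open>
  Choose a nonzero element of \<open>M\<close> with the smallest number of nonzero coordinates and let \<open>N\<close> be the
  space of elements of \<open>M\<close> supported on the same basis vectors. By minimality a single coordinate
  determines an element of \<open>N\<close>, and by irreducibility of \<open>V\<close> this coordinate takes all values in \<open>V\<close>. The other
  coordinates are therefore functions of it that commute with \<open>L\<close>, hence scalars, and so \<open>N\<close> consists of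
  pure tensors \<open>z \<otimes> y\<close> with a fixed \<open>z\<close>. Irreducibility of \<open>P\<close> then spreads \<open>z\<close> over all of \<open>P\<close>.
\<close>

lemma irreducible_tensor_product:
  fixes \<pi> :: "'k \<Rightarrow> 'p::complex_vector \<Rightarrow> 'p" and \<rho> :: "'l \<Rightarrow> 'v::complex_vector \<Rightarrow> 'v"
  assumes irr: "irreducible_action K \<pi>" "irreducible_action L \<rho>"
    and \<pi>: "\<And>X. X \<in> K \<Longrightarrow> clinear (\<pi> X)" and \<rho>: "\<And>X. X \<in> L \<Longrightarrow> clinear (\<rho> X)"
    and schur: "\<And>\<phi>. clinear \<phi> \<Longrightarrow> (\<And>X v. X \<in> L \<Longrightarrow> \<phi> (\<rho> X v) = \<rho> X (\<phi> v)) \<Longrightarrow> \<exists>c. \<forall>v. \<phi> v = c *\<^sub>C v"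
    and M: "csubspace M" "M \<noteq> {0}"
    and M_left: "\<And>X t. X \<in> K \<Longrightarrow> t \<in> M \<Longrightarrow> tensor_left (\<pi> X) t \<in> M"
    and M_right: "\<And>X t. X \<in> L \<Longrightarrow> t \<in> M \<Longrightarrow> tensor_right (\<rho> X) t \<in> M"
  shows "M = UNIV"
proof -
  obtain B :: "'p set" where B: "complex_vector.independent B" "cspan B = UNIV"
    by (rule basis_obtain)
  note co_lin = clinear_coordinate[OF B]
  define supp where "supp t = {b. coordinate B b t \<noteq> 0}" for t :: "('p, 'v) tensor"
  have fin: "finite (supp t)" for t unfolding supp_def by (rule coordinate_expansion(1)[OF B])
  have "\<exists>t. t \<in> M \<and> t \<noteq> 0" using M complex_vector.subspace_0 by blast
  then obtain t0 where t0: "t0 \<in> M" "t0 \<noteq> 0"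
    and min: "\<And>t. t \<in> M \<Longrightarrow> t \<noteq> 0 \<Longrightarrow> card (supp t0) \<le> card (supp t)"
    using ex_has_least_nat[of "\<lambda>t. t \<in> M \<and> t \<noteq> 0" _ "\<lambda>t. card (supp t)"] by blast
  obtain b0 where b0: "b0 \<in> supp t0"
    using t0(2) coordinates_eq_0[OF B, of t0] by (auto simp: supp_def)
  define N where "N = {t \<in> M. supp t \<subseteq> supp t0}"
  have supp_sub: "supp t \<subseteq> S \<longleftrightarrow> (\<forall>b. b \<notin> S \<longrightarrow> coordinate B b t = 0)" for S t
    by (auto simp: supp_def)
  have N: "csubspace N"
    unfolding N_def supp_sub
    by (rule complex_vector.subspaceI)
      (auto simp: complex_vector.subspace_0 complex_vector.subspace_add complex_vector.subspace_scale M
        clinear_0[OF co_lin] clinear_add[OF co_lin] clinear_scale[OF co_lin])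
  have N_right: "tensor_right (\<rho> X) t \<in> N" if "X \<in> L" "t \<in> N" for X t
    using that M_right clinear_0[OF \<rho>]
    by (auto simp: N_def supp_sub coordinate_tensor_right[OF B \<rho>])
  have inj: "t = 0" if t: "t \<in> N" "coordinate B b0 t = 0" for t
  proof (rule ccontr)
    assume "t \<noteq> 0"
    have "supp t \<subset> supp t0" using t b0 by (auto simp: N_def supp_def)
    then have "card (supp t) < card (supp t0)" by (rule psubset_card_mono[OF fin])
    with min[of t] t \<open>t \<noteq> 0\<close> show False by (auto simp: N_def)
  qed
  have surj: "coordinate B b0 ` N = UNIV"
  proof -
    have "submodule L \<rho> (coordinate B b0 ` N)"
      unfolding submodule_def
    proof (intro conjI ballI complex_vector.subspaceI)
      show "0 \<in> coordinate B b0 ` N"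
        using complex_vector.subspace_0[OF N] clinear_0[OF co_lin] by (metis image_eqI)
      fix x assume "x \<in> coordinate B b0 ` N"
      then obtain s where s: "s \<in> N" "x = coordinate B b0 s" by blast
      show "c *\<^sub>C x \<in> coordinate B b0 ` N" for c
        using complex_vector.subspace_scale[OF N s(1)] s(2) clinear_scale[OF co_lin] by (metis image_eqI)
      show "\<rho> X x \<in> coordinate B b0 ` N" if "X \<in> L" for X
        using N_right[OF that s(1)] s(2) coordinate_tensor_right[OF B \<rho>[OF that]] by (metis image_eqI)
      fix y assume "y \<in> coordinate B b0 ` N"
      then obtain t where t: "t \<in> N" "y = coordinate B b0 t" by blast
      show "x + y \<in> coordinate B b0 ` N"
        using complex_vector.subspace_add[OF N s(1) t(1)] s(2) t(2) clinear_add[OF co_lin] by (metis image_eqI)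
    qed
    moreover have "coordinate B b0 t0 \<noteq> 0" "t0 \<in> N" using b0 t0 by (auto simp: N_def supp_def)
    ultimately show ?thesis using irr(2) unfolding irreducible_action_def by blast
  qed
  \<comment> \<open>the inverse of the bijective coordinate map from \<open>N\<close> to \<open>V\<close>\<close>
  define lift where "lift y = (THE t. t \<in> N \<and> coordinate B b0 t = y)" for y
  have unique: "s = t" if "s \<in> N" "t \<in> N" "coordinate B b0 s = coordinate B b0 t" for s t
    using inj[of "s - t"] that complex_vector.subspace_diff[OF N] by (simp add: clinear_diff[OF co_lin])
  have lift: "lift y \<in> N \<and> coordinate B b0 (lift y) = y" for y
    unfolding lift_def
  proof (rule theI')
    have "y \<in> coordinate B b0 ` N" using surj by simp
    then obtain t where t: "t \<in> N" "coordinate B b0 t = y" by auto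
    show "\<exists>!t. t \<in> N \<and> coordinate B b0 t = y"
    proof (rule ex1I[of _ t])
      show "t \<in> N \<and> coordinate B b0 t = y" using t by blast
      show "s = t" if "s \<in> N \<and> coordinate B b0 s = y" for s
        using that t by (intro unique) simp_all
    qed
  qed
  have lift_lin: "clinear lift"
    unfolding clinear_iff
  proof (intro conjI allI; rule unique)
    show "lift (x + y) \<in> N" "lift (c *\<^sub>C x) \<in> N" "lift x + lift y \<in> N" "c *\<^sub>C lift x \<in> N" for x y c
      using lift N by (auto intro: complex_vector.subspace_add complex_vector.subspace_scale)
  qed (simp_all add: lift clinear_add[OF co_lin] clinear_scale[OF co_lin])
  have lift_comm: "lift (\<rho> X y) = tensor_right (\<rho> X) (lift y)" if "X \<in> L" for X y
    by (rule unique) (simp_all add: lift N_right that coordinate_tensor_right[OF B \<rho>])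
  have "\<exists>c. \<forall>y. coordinate B b (lift y) = c *\<^sub>C y" for b
  proof (rule schur)
    show "clinear (\<lambda>y. coordinate B b (lift y))" by (rule clinear_compose[OF co_lin lift_lin])
    show "coordinate B b (lift (\<rho> X y)) = \<rho> X (coordinate B b (lift y))" if "X \<in> L" for X y
      unfolding lift_comm[OF that] by (rule coordinate_tensor_right[OF B \<rho>[OF that]])
  qed
  then obtain c where c: "\<And>b y. coordinate B b (lift y) = c b *\<^sub>C y" by metis
  define z where "z = (\<Sum>b\<in>supp t0. c b *\<^sub>C b)"
  have lift_pure: "lift y = z \<otimes>\<^sub>t y" for y
  proof -
    have "lift y = (\<Sum>b\<in>supp (lift y). b \<otimes>\<^sub>t c b *\<^sub>C y)"
      using coordinate_expansion(2)[OF B, of "lift y"] unfolding supp_def c .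
    also have "\<dots> = (\<Sum>b\<in>supp t0. b \<otimes>\<^sub>t c b *\<^sub>C y)"
      by (rule sum.mono_neutral_left) (use lift[of y] fin in \<open>auto simp: N_def supp_def c pure_tensor_zero\<close>)
    finally show ?thesis
      by (simp add: z_def clinear_sum[OF clinear_pure_tensor(2)] pure_tensor_linear)
  qed
  define P where "P = {x. \<forall>y. x \<otimes>\<^sub>t y \<in> M}"
  have "submodule K \<pi> P"
    unfolding submodule_def
  proof (intro conjI ballI complex_vector.subspaceI)
    show "0 \<in> P" "\<And>x y. x \<in> P \<Longrightarrow> y \<in> P \<Longrightarrow> x + y \<in> P" "\<And>c x. x \<in> P \<Longrightarrow> c *\<^sub>C x \<in> P"
      by (simp_all add: P_def pure_tensor_linear pure_tensor_zero complex_vector.subspace_0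
          complex_vector.subspace_add complex_vector.subspace_scale M)
    fix X x assume "X \<in> K" "x \<in> P"
    then have "tensor_left (\<pi> X) (x \<otimes>\<^sub>t y) \<in> M" for y by (simp add: M_left P_def)
    then show "\<pi> X x \<in> P" by (simp add: P_def tensor_left_pure[OF \<pi>] \<open>X \<in> K\<close>)
  qed
  moreover have "z \<in> P" using lift lift_pure by (auto simp: P_def N_def)
  moreover have "z \<noteq> 0"
  proof
    assume "z = 0"
    then have "lift y = 0" for y by (simp add: lift_pure pure_tensor_zero)
    then have "y = 0" for y :: 'v using lift[of y] by (simp add: clinear_0[OF co_lin])
    then show False using irr(2) by (auto simp: irreducible_action_def)
  qed
  ultimately have "P = UNIV" using irr(1) unfolding irreducible_action_def by blast
  then have "{x \<otimes>\<^sub>t y | x y. True} \<subseteq> M" by (auto simp: P_def)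
  then have "cspan {x \<otimes>\<^sub>t y | x y. True} \<subseteq> M" by (rule complex_vector.span_minimal[OF _ M(1)])
  then show ?thesis using tensor_span by blast
qed

section \<open>Modules over the special linear Lie algebra\<close>

lemma matrix_unit_nth: "matrix_unit i j $ a $ b = (if a = i \<and> b = j then 1 else 0)"
  by (simp add: matrix_unit_def)

lemma trace_matrix_unit: "trace (matrix_unit i j) = (if i = j then 1 else 0)"
  by (auto simp: trace_def matrix_unit_nth if_distrib cong: if_cong intro!: sum.neutral)

lemma matrix_unit_mult:
  "matrix_unit i j ** matrix_unit k l = (if j = k then matrix_unit i l else 0)"
proof -
  have "(\<Sum>c\<in>UNIV. matrix_unit i j $ a $ c * matrix_unit k l $ c $ b)
      = (\<Sum>c\<in>UNIV. if c = j then (if j = k \<and> a = i \<and> b = l then 1 else 0) else 0)" for a b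
    by (rule sum.cong) (auto simp: matrix_unit_nth)
  then show ?thesis
    by (auto simp: vec_eq_iff matrix_matrix_mult_def matrix_unit_nth)
qed

lemma mat_bracket_unit:
  "mat_bracket (matrix_unit i j) (matrix_unit k l)
    = (if j = k then matrix_unit i l else 0) - (if l = i then matrix_unit k j else 0)"
  by (simp add: mat_bracket_def matrix_unit_mult)

definition diag_diff :: "'n::finite \<Rightarrow> 'n \<Rightarrow> 'n sqmat"
  where "diag_diff i j = matrix_unit i i - matrix_unit j j"

lemma csubspace_sl: "csubspace sl"
  by (rule complex_vector.subspaceI)
    (simp_all add: sl_def trace_add trace_def[of "_ *\<^sub>C _"] sum_distrib_left[symmetric] trace_def[of 0],
      simp add: trace_def)

lemma
  shows matrix_unit_in_sl: "i \<noteq> j \<Longrightarrow> matrix_unit i j \<in> sl"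
    and diag_diff_in_sl: "diag_diff i j \<in> sl"
    and mat_bracket_in_sl: "mat_bracket A B \<in> sl"
  by (simp_all add: sl_def diag_diff_def mat_bracket_def trace_matrix_unit trace_sub
      trace_mul_sym[of A B])

lemma sl_induct [consumes 1, case_names unit diag zero add scale]:
  assumes "A \<in> sl"
    and unit: "\<And>i j. i \<noteq> j \<Longrightarrow> P (matrix_unit i j)" and diag: "\<And>i j. P (diag_diff i j)"
    and zero: "P 0"
    and add: "\<And>A B. A \<in> sl \<Longrightarrow> B \<in> sl \<Longrightarrow> P A \<Longrightarrow> P B \<Longrightarrow> P (A + B)"
    and scale: "\<And>c A. A \<in> sl \<Longrightarrow> P A \<Longrightarrow> P (c *\<^sub>C A)"
  shows "P (A :: 'n::finite sqmat)"
proof -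
  let ?S = "{A \<in> sl. P A}"
  \<comment> \<open>The off-diagonal units together with all \<open>E\<^sub>i\<^sub>i - E\<^sub>k\<^sub>k\<close>, for one fixed \<open>k\<close>, span \<open>sl\<close>.\<close>
  obtain k :: 'n where True by simp
  define G where "G i j = (if i = j then diag_diff i k else matrix_unit i j)" for i j
  have sub: "csubspace ?S"
    using zero add scale
    by (auto intro!: complex_vector.subspaceI simp: complex_vector.subspace_0[OF csubspace_sl]
        complex_vector.subspace_add[OF csubspace_sl] complex_vector.subspace_scale[OF csubspace_sl])
  have "G i j \<in> ?S" for i j
    by (simp add: G_def unit diag matrix_unit_in_sl diag_diff_in_sl)
  then have mem: "(\<Sum>i\<in>UNIV. \<Sum>j\<in>UNIV. (A $ i $ j) *\<^sub>C G i j) \<in> ?S"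
    by (intro complex_vector.subspace_sum[OF sub] complex_vector.subspace_scale[OF sub])
  have "(\<Sum>i\<in>UNIV. \<Sum>j\<in>UNIV. (A $ i $ j) *\<^sub>C G i j) $ a $ b = A $ a $ b" for a b
  proof -
    have "A $ i $ j * G i j $ a $ b
        = (if j = b then (if i = a then A $ a $ b else 0) else 0)
          - (if j = i then (if a = k \<and> b = k then A $ i $ i else 0) else 0)" for i j
      by (auto simp: G_def diag_diff_def matrix_unit_nth)
    then have "(\<Sum>i\<in>UNIV. \<Sum>j\<in>UNIV. (A $ i $ j) *\<^sub>C G i j) $ a $ b
        = A $ a $ b - (if a = k \<and> b = k then trace A else 0)"
      by (cases "a = k \<and> b = k") (auto simp: sum_component sum_subtractf trace_def)
    with \<open>A \<in> sl\<close> show ?thesis by (simp add: sl_def)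
  qed
  then have "(\<Sum>i\<in>UNIV. \<Sum>j\<in>UNIV. (A $ i $ j) *\<^sub>C G i j) = A" by (simp add: vec_eq_iff)
  with mem show ?thesis by simp
qed

text \<open>
  The value at \<open>E\<^sub>i\<^sub>i - E\<^sub>j\<^sub>j\<close> of the root \<open>\<epsilon>\<^sub>k - \<epsilon>\<^sub>l\<close>, to which \<open>E\<^sub>k\<^sub>l\<close> belongs.
\<close>

definition root_value :: "'n \<Rightarrow> 'n \<Rightarrow> 'n \<Rightarrow> 'n \<Rightarrow> int"
  where "root_value i j k l = of_bool (i = k) - of_bool (i = l) - of_bool (j = k) + of_bool (j = l)"

lemma mat_bracket_diff_left: "mat_bracket (A - B) C = mat_bracket A C - mat_bracket B C"
  by (simp add: mat_bracket_def matrix_matrix_mult_def vec_eq_iff sum_subtractf left_diff_distrib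
      right_diff_distrib)

lemma mat_bracket_diff_right: "mat_bracket A (B - C) = mat_bracket A B - mat_bracket A C"
  by (simp add: mat_bracket_def matrix_matrix_mult_def vec_eq_iff sum_subtractf left_diff_distrib
      right_diff_distrib)

lemma diag_diff_bracket_unit:
  "mat_bracket (diag_diff i j) (matrix_unit k l) = of_int (root_value i j k l) *\<^sub>C matrix_unit k l"
  unfolding diag_diff_def mat_bracket_diff_left mat_bracket_unit root_value_def
  by (auto simp: vec_eq_iff)

lemma irreducible_eq_UNIV:
  "irreducible_action L \<rho> \<Longrightarrow> submodule L \<rho> M \<Longrightarrow> v \<in> M \<Longrightarrow> v \<noteq> 0 \<Longrightarrow> M = UNIV"
  unfolding irreducible_action_def by blast

lemma span_image_subset:
  assumes "clinear f" "\<And>x. x \<in> B \<Longrightarrow> f x \<in> cspan B" "x \<in> cspan B"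
  shows "f x \<in> cspan B"
  using assms(3)
proof (induction rule: complex_vector.span_induct_alt)
  case base
  show ?case by (simp add: clinear_0[OF assms(1)] complex_vector.span_zero)
next
  case (step c x y)
  then show ?case
    by (simp add: clinear_add[OF assms(1)] clinear_scale[OF assms(1)] complex_vector.span_add
        complex_vector.span_scale assms(2))
qed

locale sl_module =
  fixes \<rho> :: "'n::finite sqmat \<Rightarrow> 'v::complex_vector \<Rightarrow> 'v"
  assumes lie: "lie_module sl mat_bracket \<rho>"
begin

lemma linear: "A \<in> sl \<Longrightarrow> clinear (\<rho> A)"
  and add: "A \<in> sl \<Longrightarrow> B \<in> sl \<Longrightarrow> \<rho> (A + B) y = \<rho> A y + \<rho> B y"
  and scale: "A \<in> sl \<Longrightarrow> \<rho> (c *\<^sub>C A) y = c *\<^sub>C \<rho> A y"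
  and bracket: "A \<in> sl \<Longrightarrow> B \<in> sl \<Longrightarrow> \<rho> (mat_bracket A B) y = \<rho> A (\<rho> B y) - \<rho> B (\<rho> A y)"
  using lie by (simp_all add: lie_module_def linear_action_def)

lemma zero: "\<rho> 0 y = 0"
  using scale[of 0 0 y] by (simp add: complex_vector.subspace_0[OF csubspace_sl])

lemma diff: "A \<in> sl \<Longrightarrow> B \<in> sl \<Longrightarrow> \<rho> (A - B) y = \<rho> A y - \<rho> B y"
  using add[of "A - B" B y] complex_vector.subspace_diff[OF csubspace_sl, of A B]
  by (simp add: algebra_simps)

abbreviation unit where "unit i j \<equiv> \<rho> (matrix_unit i j)"
abbreviation cartan where "cartan i j \<equiv> \<rho> (diag_diff i j)"

lemma unit_linear: "i \<noteq> j \<Longrightarrow> clinear (unit i j)"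
  and cartan_linear: "clinear (cartan i j)"
  by (simp_all add: linear matrix_unit_in_sl diag_diff_in_sl)

lemma cartan_eq: "i \<noteq> j \<Longrightarrow> cartan i j y = unit i j (unit j i y) - unit j i (unit i j y)"
  using bracket[of "matrix_unit i j" "matrix_unit j i" y]
  by (simp add: mat_bracket_unit matrix_unit_in_sl diag_diff_def)

lemma cartan_unit:
  "k \<noteq> l \<Longrightarrow> cartan i j (unit k l y) = unit k l (cartan i j y)
    + of_int (root_value i j k l) *\<^sub>C unit k l y"
  using bracket[of "diag_diff i j" "matrix_unit k l" y] scale[of "matrix_unit k l"]
  by (simp add: diag_diff_bracket_unit matrix_unit_in_sl diag_diff_in_sl algebra_simps)

lemma cartan_commute: "cartan i j (cartan k l y) = cartan k l (cartan i j y)"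
proof -
  have "mat_bracket (diag_diff i j) (diag_diff k l) = 0"
    unfolding diag_diff_def mat_bracket_diff_left mat_bracket_diff_right mat_bracket_unit by auto
  then show ?thesis
    using bracket[of "diag_diff i j" "diag_diff k l" y] by (simp add: diag_diff_in_sl zero)
qed

text \<open>
  Only the off-diagonal matrix units have to be checked, as they generate \<open>sl\<close> as a Lie algebra.
\<close>

lemma submoduleI:
  assumes N: "csubspace N" and unit: "\<And>i j y. i \<noteq> j \<Longrightarrow> y \<in> N \<Longrightarrow> unit i j y \<in> N"
  shows "submodule sl \<rho> N"
  unfolding submodule_def
proof (intro conjI ballI N)
  fix A :: "'n sqmat" and y assume "A \<in> sl" and y: "y \<in> N"
  then show "\<rho> A y \<in> N"
  proof (induction rule: sl_induct)
    case (diag i j)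
    show ?case
    proof (cases "i = j")
      case False
      then show ?thesis
        by (simp add: cartan_eq complex_vector.subspace_diff[OF N] unit y)
    qed (simp add: diag_diff_def zero complex_vector.subspace_0[OF N])
  qed (simp_all add: unit y zero add scale N complex_vector.subspace_0
      complex_vector.subspace_add complex_vector.subspace_scale)
qed

definition word :: "('n \<times> 'n) list \<Rightarrow> 'v \<Rightarrow> 'v"
  where "word ws v = foldr (\<lambda>(i, j). unit i j) ws v"

lemma word_Nil [simp]: "word [] v = v"
  and word_Cons [simp]: "word ((i, j) # ws) v = unit i j (word ws v)"
  by (simp_all add: word_def)

text \<open>
  A module generated by one vector is spanned by the words in the finitely many matrix units \<open>E\<^sub>i\<^sub>j\<close>
  applied to that vector.
\<close>

lemma countable_spanning_set:
  assumes irr: "irreducible_action sl \<rho>"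
  shows "\<exists>B::'v set. countable B \<and> cspan B = UNIV"
proof -
  obtain v :: 'v where v: "v \<noteq> 0" using irr by (auto simp: irreducible_action_def)
  let ?B = "{word ws v | ws. \<forall>(i, j)\<in>set ws. i \<noteq> j}"
  have "countable ((\<lambda>ws. word ws v) ` {ws. \<forall>(i, j)\<in>set ws. i \<noteq> j})"
    by (intro countable_image countableI_type)
  then have "countable ?B" by (simp add: setcompr_eq_image)
  have "submodule sl \<rho> (cspan ?B)"
  proof (rule submoduleI)
    fix i j :: 'n and y assume "i \<noteq> j" "y \<in> cspan ?B"
    show "unit i j y \<in> cspan ?B"
    proof (rule span_image_subset[OF unit_linear[OF \<open>i \<noteq> j\<close>] _ \<open>y \<in> _\<close>])
      fix x assume "x \<in> ?B"
      then obtain ws where "x = word ws v" "\<forall>(i, j)\<in>set ws. i \<noteq> j" by blast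
      then have "unit i j x = word ((i, j) # ws) v" "\<forall>(i, j)\<in>set ((i, j) # ws). i \<noteq> j"
        using \<open>i \<noteq> j\<close> by simp_all
      then have "unit i j x \<in> ?B" by blast
      then show "unit i j x \<in> cspan ?B" by (rule complex_vector.span_base)
    qed
  qed (rule complex_vector.subspace_span)
  moreover have "v \<in> cspan ?B"
    by (intro complex_vector.span_base CollectI exI[of _ "[]"]) simp
  ultimately have "cspan ?B = UNIV"
    using irreducible_eq_UNIV[OF irr] v by blast
  with \<open>countable ?B\<close> show ?thesis by blast
qed

text \<open>
  The common kernel of the operators \<open>(m u\<^sup>T)(m v\<^sup>T)\<close> with \<open>u\<close> and \<open>v\<close> orthogonal to \<open>m\<close>. For \<open>u = v\<close> they are
  squares of nilpotent matrices of rank at most one, among them all \<open>E\<^sub>i\<^sub>j\<close> with \<open>i \<noteq> j\<close>.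
\<close>

definition square_kernel :: "'v set"
  where "square_kernel = {y. \<forall>m u v. pairing u m = 0 \<longrightarrow> pairing v m = 0 \<longrightarrow>
    \<rho> (outer m u) (\<rho> (outer m v) y) = 0}"

end

text \<open>
  Conjugation of \<open>m u\<^sup>T\<close> by the transvection \<open>1 + t E\<^sub>k\<^sub>l\<close>. For an integer \<open>t\<close> the first vector remains
  integral, so the result is again of the form that occurs in \<open>square_kernel\<close>.
\<close>

lemma outer_transvection:
  fixes m :: "int^'n::finite"
  assumes "k \<noteq> l" and u: "pairing u m = 0"
  defines "E \<equiv> matrix_unit k l"
    and "m' \<equiv> (\<lambda>t::nat. m + of_nat t * axis k (m $ l))"
    and "u' \<equiv> (\<lambda>t::nat. u - of_nat t *\<^sub>C axis l (u $ k))"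
  shows "pairing (u' t) (m' t) = 0"
    and "outer (m' t) (u' t) = outer m u + of_nat t *\<^sub>C mat_bracket E (outer m u)
      - (of_nat t ^ 2 * (of_int (m $ l) * u $ k)) *\<^sub>C E"
proof -
  have axis: "pairing (axis l a) r = a * of_int (r $ l)" "pairing v (axis k b) = v $ k * of_int b"
    for a b r and v :: "complex^'n"
    by (simp_all add: pairing_def axis_def if_distrib if_distribR cong: if_cong)
  have "(of_nat t * axis k (m $ l)) = axis k (int t * m $ l)" by (simp add: vec_eq_iff axis_def of_nat_index)
  then show "pairing (u' t) (m' t) = 0"
    unfolding u'_def m'_def using assms(1)
    by (simp add: pairing_diff pairing_scale pairing_add_right axis u) (simp add: axis_def)
  have "(E ** outer m u) $ i $ j = (if i = k then of_int (m $ l) * u $ j else 0)"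
    "(outer m u ** E) $ i $ j = (if j = l then of_int (m $ i) * u $ k else 0)" for i j
    by (simp_all add: E_def matrix_matrix_mult_def matrix_unit_nth outer_def if_distrib if_distribR
        cong: if_cong conj_cong)
  then show "outer (m' t) (u' t) = outer m u + of_nat t *\<^sub>C mat_bracket E (outer m u)
      - (of_nat t ^ 2 * (of_int (m $ l) * u $ k)) *\<^sub>C E"
    by (simp add: vec_eq_iff mat_bracket_def)
      (simp add: outer_def E_def matrix_unit_nth u'_def m'_def axis_def of_nat_index algebra_simps power2_eq_square)
qed

context sl_module
begin

text \<open>
  The set of operators defining \<open>square_kernel\<close> is stable under conjugation by \<open>1 + t E\<^sub>k\<^sub>l\<close> for integers \<open>t\<close>;
  the derivative of this at \<open>t = 0\<close> is stability of the kernel under \<open>E\<^sub>k\<^sub>l\<close>. Concretely, the conjugated product applied to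
  \<open>y\<close> is a polynomial in \<open>t\<close> that vanishes at all natural numbers, and its linear coefficient is the
  commutator of \<open>E\<^sub>k\<^sub>l\<close> with the product.
\<close>

lemma submodule_square_kernel: "submodule sl \<rho> square_kernel"
proof (rule submoduleI)
  have sl: "outer m u \<in> sl" if "pairing u m = 0" for u m using that by (simp add: outer_in_sl)
  note lin = linear[OF sl]
  show "csubspace square_kernel"
    unfolding square_kernel_def
    by (rule complex_vector.subspaceI)
      (simp_all add: clinear_0[OF lin] clinear_add[OF lin] clinear_scale[OF lin])
  fix k l :: 'n and y assume kl: "k \<noteq> l" and y: "y \<in> square_kernel"
  let ?E = "matrix_unit k l"
  have E: "?E \<in> sl" using kl by (rule matrix_unit_in_sl)
  show "unit k l y \<in> square_kernel"
    unfolding square_kernel_def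
  proof (intro CollectI allI impI)
    fix m :: "int^'n" and u v assume u: "pairing u m = 0" and v: "pairing v m = 0"
    let ?A = "outer m u" and ?B = "outer m v"
    let ?a = "of_int (m $ l) * u $ k" and ?b = "of_int (m $ l) * v $ k"
    have AB: "?A \<in> sl" "?B \<in> sl" using u v by (simp_all add: sl)
    have expand: "\<rho> (X + s *\<^sub>C mat_bracket ?E X - (s ^ 2 * x) *\<^sub>C ?E) w
        = \<rho> X w + s *\<^sub>C \<rho> (mat_bracket ?E X) w - (s ^ 2 * x) *\<^sub>C unit k l w"
      if "X \<in> sl" for X s x w
      by (simp add: diff add scale that E mat_bracket_in_sl complex_vector.subspace_add[OF csubspace_sl]
          complex_vector.subspace_scale[OF csubspace_sl])
    let ?A' = "\<rho> (mat_bracket ?E ?A)" and ?B' = "\<rho> (mat_bracket ?E ?B)"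
    \<comment> \<open>the coefficients of \<open>t\<^sup>0, \<dots>, t\<^sup>4\<close> in the product of the two conjugated factors, applied to \<open>y\<close>\<close>
    define c where "c i = [\<rho> ?A (\<rho> ?B y), \<rho> ?A (?B' y) + ?A' (\<rho> ?B y),
      ?A' (?B' y) - ?b *\<^sub>C \<rho> ?A (unit k l y) - ?a *\<^sub>C unit k l (\<rho> ?B y),
      - (?b *\<^sub>C ?A' (unit k l y)) - ?a *\<^sub>C unit k l (?B' y),
      (?a * ?b) *\<^sub>C unit k l (unit k l y)] ! i" for i
    note L = linear[OF AB(1)] linear[OF mat_bracket_in_sl, of ?E ?A] linear[OF E]
    have "(\<Sum>i\<le>4. of_nat t ^ i *\<^sub>C c i) \<in> {0}" for t
    proof -
      let ?m = "m + of_nat t * axis k (m $ l)"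
      note tv = outer_transvection[OF kl u, of t] outer_transvection[OF kl v, of t]
      have "\<rho> (outer ?m (u - of_nat t *\<^sub>C axis l (u $ k))) (\<rho> (outer ?m (v - of_nat t *\<^sub>C axis l (v $ k))) y) = 0"
        (is "?lhs = 0") using y tv(1,3) unfolding square_kernel_def by blast
      moreover have "(\<Sum>i\<le>4. of_nat t ^ i *\<^sub>C c i) = ?lhs"
        unfolding tv(2,4) expand[OF AB(1)] expand[OF AB(2)]
        by (simp add: c_def eval_nat_numeral clinear_add[OF L(1)] clinear_add[OF L(2)] clinear_add[OF L(3)]
            clinear_diff[OF L(1)] clinear_diff[OF L(2)] clinear_diff[OF L(3)]
            clinear_scale[OF L(1)] clinear_scale[OF L(2)] clinear_scale[OF L(3)]
            scaleC_add_right complex_vector.scale_right_diff_distrib scaleC_one algebra_simps)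
      ultimately show ?thesis by simp
    qed
    from poly_coeffs_in_subspace[OF complex_vector.subspace_single_0 this, of 1]
    have "\<rho> ?A (?B' y) + ?A' (\<rho> ?B y) = 0" by (simp add: c_def)
    moreover have "\<rho> ?A (\<rho> ?B y) = 0" using y u v by (simp add: square_kernel_def)
    ultimately show "\<rho> ?A (\<rho> ?B (unit k l y)) = 0"
      by (simp add: bracket E AB clinear_diff[OF L(1)] clinear_0[OF L(3)])
  qed
qed

end

section \<open>Modules on which root vectors square to zero\<close>

locale square_zero_module = sl_module \<rho> for \<rho> :: "'n::{finite,linorder} sqmat \<Rightarrow> 'v::complex_vector \<Rightarrow> 'v" +
  assumes square_zero: "i \<noteq> j \<Longrightarrow> unit i j (unit i j y) = 0"
begin

text \<open>
  With \<open>e = E\<^sub>i\<^sub>j\<close>, \<open>f = E\<^sub>j\<^sub>i\<close> and \<open>h = [e, f]\<close> the relation \<open>[h, e] = 2 e\<close> becomes \<open>2 e f e = 2 e\<close> as soon as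
  \<open>e\<^sup>2 = 0\<close>. It follows that \<open>h e = e\<close>, \<open>h f = - f\<close>, \<open>h\<^sup>2 = e f + f e\<close> and \<open>h\<^sup>3 = h\<close>.
\<close>

lemma unit_triple:
  assumes "i \<noteq> j"
  shows "unit i j (unit j i (unit i j y)) = unit i j y"
proof -
  have "cartan i j (unit i j y) = unit i j (cartan i j y) + 2 *\<^sub>C unit i j y"
    using cartan_unit[OF assms, of i j y] assms by (simp add: root_value_def)
  then have "2 *\<^sub>C unit i j (unit j i (unit i j y)) = 2 *\<^sub>C unit i j y"
    using assms
    by (simp add: cartan_eq clinear_diff[OF unit_linear] square_zero clinear_0[OF unit_linear]
        complex_vector.scale_left_distrib[of 1 1, simplified] algebra_simps)
  then show ?thesis by simp
qed

lemma cartan_unit_eigen: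
  assumes "i \<noteq> j"
  shows "cartan i j (unit i j y) = unit i j y" and "cartan i j (unit j i y) = - unit j i y"
  using assms unit_triple[OF assms] unit_triple[OF assms[symmetric]]
  by (simp_all add: cartan_eq square_zero clinear_0[OF unit_linear])

lemma cartan_square:
  assumes "i \<noteq> j"
  shows "cartan i j (cartan i j y) = unit i j (unit j i y) + unit j i (unit i j y)"
  using assms
  by (simp add: cartan_eq[of i j y] clinear_diff[OF cartan_linear] cartan_unit_eigen)

lemma cartan_cube: "cartan i j (cartan i j (cartan i j y)) = cartan i j y"
proof (cases "i = j")
  case False
  then show ?thesis
    unfolding cartan_square[OF False]
    by (simp add: cartan_eq[of i j y] clinear_add[OF cartan_linear] cartan_unit_eigen)
qed (simp add: diag_diff_def zero)

definition weight_vector :: "'v \<Rightarrow> bool"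
  where "weight_vector v \<longleftrightarrow> v \<noteq> 0 \<and> (\<forall>i j. \<exists>c::int. cartan i j v = of_int c *\<^sub>C v)"

lemma weight_bound:
  assumes "cartan i j v = of_int c *\<^sub>C v" "v \<noteq> 0"
  shows "\<bar>c\<bar> \<le> 1"
proof -
  have "(of_int c * of_int c * of_int c) *\<^sub>C v = of_int c *\<^sub>C v"
    using cartan_cube[of i j v] assms by (simp add: clinear_scale[OF cartan_linear] mult.assoc)
  then have "complex_of_int (c * c * c) = of_int c" using assms(2) by simp
  then have "c * c * c = c" by (simp only: of_int_eq_iff)
  then have "c = 0 \<or> c * c = 1" by simp
  then show ?thesis by (metis abs_mult_self_eq abs_1 abs_0 mult_cancel_right1 order_refl zero_le_one
    power2_eq_square power2_eq_1_iff abs_minus_cancel)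
qed

text \<open>
  By \<open>h\<^sup>3 = h\<close> a vector \<open>v\<close> is a combination of the eigenvectors \<open>v - h\<^sup>2 v\<close> and \<open>h\<^sup>2 v \<plusminus> h v\<close>, one of which is nonzero.
  The coroots commute, so this can be done for all of them in turn without losing the eigenvector
  property for the previous ones.
\<close>

lemma weight_vector_exists:
  assumes "(v0 :: 'v) \<noteq> 0"
  shows "\<exists>v. weight_vector v"
proof -
  have "\<exists>v. v \<noteq> 0 \<and> (\<forall>(i, j)\<in>S. \<exists>c::int. cartan i j v = of_int c *\<^sub>C v)" if "finite S" for S :: "('n \<times> 'n) set"
    using that
  proof induction
    case empty
    show ?case using assms by (intro exI[of _ v0]) simp
  next
    case (insert x S)
    obtain i j where x: "x = (i, j)" by force
    obtain v where v: "v \<noteq> 0" and S: "\<And>k l. (k, l) \<in> S \<Longrightarrow> \<exists>c::int. cartan k l v = of_int c *\<^sub>C v"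
      using insert by blast
    let ?h = "cartan i j"
    let ?u = "\<lambda>c. if c = 0 then v - ?h (?h v) else ?h (?h v) + of_int c *\<^sub>C ?h v"
    have "\<exists>c\<in>{0, 1, - 1 :: int}. ?u c \<noteq> 0"
    proof (rule ccontr)
      assume "\<not> ?thesis"
      then have "?u 0 = 0" "?u 1 = 0" "?u (- 1) = 0" by blast+
      then have zero: "?h (?h v) = v" "?h (?h v) + ?h v = 0" "?h (?h v) - ?h v = 0"
        by (simp_all add: scaleC_one)
      have "v + v = (?h (?h v) + ?h v) + (?h (?h v) - ?h v)" by (simp add: zero(1))
      then have "v + v = 0" by (simp only: zero(2,3) add_0_left)
      then have "2 *\<^sub>C v = 0" using scaleC_add_left[of 1 1 v] by simp
      with v show False by simp
    qed
    then obtain c :: int where c: "c \<in> {0, 1, - 1}" "?u c \<noteq> 0" by blast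
    have "?h (?u c) = of_int c *\<^sub>C ?u c"
      using c(1) by (auto simp: clinear_add[OF cartan_linear] clinear_diff[OF cartan_linear]
          clinear_scale[OF cartan_linear] cartan_cube)
    moreover have "\<exists>d::int. cartan k l (?u c) = of_int d *\<^sub>C ?u c" if kl: "(k, l) \<in> S" for k l
    proof -
      obtain d :: int where d: "cartan k l v = of_int d *\<^sub>C v" using S[OF kl] by blast
      have "cartan k l (?h v) = of_int d *\<^sub>C ?h v"
        by (simp add: cartan_commute[of k l] d clinear_scale[OF cartan_linear])
      moreover from this have "cartan k l (?h (?h v)) = of_int d *\<^sub>C ?h (?h v)"
        by (simp add: cartan_commute[of k l] d clinear_scale[OF cartan_linear])
      ultimately have "cartan k l (?u c) = of_int d *\<^sub>C ?u c"
        by (simp add: clinear_add[OF cartan_linear] clinear_diff[OF cartan_linear] d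
          clinear_scale[OF cartan_linear] scaleC_add_right complex_vector.scale_right_diff_distrib mult.commute)
      then show ?thesis by blast
    qed
    ultimately show ?case using c(2) unfolding x by (intro exI[of _ "?u c"]) blast
  qed
  from this[of UNIV] show ?thesis by (auto simp: weight_vector_def)
qed

text \<open>
  Any strictly decreasing function from the indices to the natural numbers would do. It defines the element
  \<open>\<Sum>\<^sub>i\<^sub>j height i (E\<^sub>i\<^sub>i - E\<^sub>j\<^sub>j)\<close> of the Cartan subalgebra, on which the roots of the upper triangular \<open>E\<^sub>k\<^sub>l\<close> are
  positive integers.
\<close>

definition height :: "'n \<Rightarrow> int"
  where "height i = int (card {j. i < j})"

lemma height_less: "i < j \<Longrightarrow> height j < height i"
  unfolding height_def by (auto intro!: psubset_card_mono)

definition height_bound :: int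
  where "height_bound = (\<Sum>i\<in>UNIV. \<Sum>j\<in>(UNIV :: 'n set). height i)"

text \<open>
  \<open>v\<close> is a weight vector and \<open>a\<close> is the eigenvalue on it of \<open>\<Sum>\<^sub>i\<^sub>j height i (E\<^sub>i\<^sub>i - E\<^sub>j\<^sub>j)\<close>.
\<close>

definition weight_height :: "'v \<Rightarrow> int \<Rightarrow> bool"
  where "weight_height v a \<longleftrightarrow> v \<noteq> 0 \<and> (\<exists>c. (\<forall>i j. cartan i j v = of_int (c i j) *\<^sub>C v) \<and>
    a = (\<Sum>i\<in>UNIV. \<Sum>j\<in>UNIV. height i * c i j))"

lemma weight_height_exists: "weight_vector v \<Longrightarrow> \<exists>a. weight_height v a"
  unfolding weight_vector_def weight_height_def by metis

lemma weight_height_weight_vector: "weight_height v a \<Longrightarrow> weight_vector v"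
  unfolding weight_vector_def weight_height_def by metis

lemma weight_height_bound:
  assumes "weight_height v a"
  shows "\<bar>a\<bar> \<le> height_bound"
proof -
  obtain c where v: "v \<noteq> 0" and c: "\<And>i j. cartan i j v = of_int (c i j) *\<^sub>C v"
    and a: "a = (\<Sum>i\<in>UNIV. \<Sum>j\<in>UNIV. height i * c i j)" using assms unfolding weight_height_def by blast
  have "\<bar>height i * c i j\<bar> \<le> height i" for i j
    using mult_left_mono[OF weight_bound[OF c v], of "height i" i j] by (simp add: height_def abs_mult)
  then show ?thesis
    unfolding a height_bound_def by (intro order_trans[OF sum_abs] sum_mono order_trans[OF sum_abs])
qed

lemma weight_height_unit:
  assumes "weight_height v a" "k \<noteq> l" "unit k l v \<noteq> 0"
  shows "weight_height (unit k l v) (a + int CARD('n) * (height k - height l))"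
proof -
  obtain c where c: "\<And>i j. cartan i j v = of_int (c i j) *\<^sub>C v"
    and a: "a = (\<Sum>i\<in>UNIV. \<Sum>j\<in>UNIV. height i * c i j)" using assms unfolding weight_height_def by blast
  have "cartan i j (unit k l v) = of_int (c i j + root_value i j k l) *\<^sub>C unit k l v" for i j
    by (simp add: cartan_unit assms(2) c clinear_scale[OF unit_linear] scaleC_add_left)
  moreover have "a + int CARD('n) * (height k - height l)
      = (\<Sum>i\<in>UNIV. \<Sum>j\<in>UNIV. height i * (c i j + root_value i j k l))"
  proof -
    have "(\<Sum>i\<in>UNIV. \<Sum>j\<in>UNIV. height i * root_value i j k l) = int CARD('n) * (height k - height l)"
    proof -
      have eq: "height i * root_value i j k l = (if i = k then height i else 0) - (if i = l then height i else 0)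
          - (if j = k then height i else 0) + (if j = l then height i else 0)" for i j
        by (simp add: root_value_def of_bool_def)
      show ?thesis
        unfolding eq by (simp add: sum.distrib sum_subtractf sum_distrib_left[symmetric] algebra_simps)
    qed
    then show ?thesis by (simp add: a distrib_left sum.distrib)
  qed
  ultimately show ?thesis
    using assms(3) unfolding weight_height_def
    by (intro conjI exI[of _ "\<lambda>i j. c i j + root_value i j k l"]) simp_all
qed

text \<open>
  The sign \<open>s\<close> treats raising words (\<open>s = 1\<close>) and lowering words (\<open>s = - 1\<close>) together: each letter moves
  the height by at least one in the direction \<open>s\<close>.
\<close>

lemma word_height:
  assumes "weight_height v a" "word ws v \<noteq> 0" and s: "\<bar>s\<bar> = 1"
    and "\<forall>(i, j)\<in>set ws. s * height j < s * height i"
  shows "\<exists>b. weight_height (word ws v) b \<and> int (length ws) \<le> s * (b - a)"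
  using assms(2,4)
proof (induction ws)
  case Nil
  then show ?case using assms(1) by auto
next
  case (Cons x ws)
  obtain i j where x: "x = (i, j)" by force
  have ij: "s * height j < s * height i" using Cons.prems x by simp
  then have "i \<noteq> j" by auto
  have ne: "unit i j (word ws v) \<noteq> 0" using Cons.prems x by simp
  then have "word ws v \<noteq> 0" using clinear_0[OF unit_linear[OF \<open>i \<noteq> j\<close>]] by metis
  with Cons obtain b where b: "weight_height (word ws v) b" "int (length ws) \<le> s * (b - a)" by auto
  let ?d = "int CARD('n) * (height i - height j)"
  have "1 * 1 \<le> int CARD('n) * (s * (height i - height j))"
    using ij by (intro mult_mono) (simp_all add: algebra_simps)
  then have "int (length (x # ws)) \<le> s * (b + ?d - a)" using b(2) by (simp add: algebra_simps)
  with weight_height_unit[OF b(1) \<open>i \<noteq> j\<close> ne] show ?case by (auto simp: x)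
qed

text \<open>
  All weights have heights in a bounded interval, so a long raising or lowering word kills every
  weight vector.
\<close>

lemma word_length_bound:
  assumes "weight_vector v" "word ws v \<noteq> 0" "\<bar>s\<bar> = 1"
    and "\<forall>(i, j)\<in>set ws. s * height j < s * height i"
  shows "length ws \<le> nat (2 * height_bound)"
proof -
  obtain a where a: "weight_height v a" using weight_height_exists[OF assms(1)] by blast
  obtain b where b: "weight_height (word ws v) b" "int (length ws) \<le> s * (b - a)"
    using word_height[OF a assms(2-4)] by blast
  have "s = 1 \<or> s = - 1" using assms(3) by linarith
  then show ?thesis using b(2) weight_height_bound[OF a] weight_height_bound[OF b(1)] by auto
qed

text \<open>
  Apply to a weight vector a raising word of maximal length among those that do not kill it.
\<close>

lemma highest_weight_vector_exists:
  assumes "(v0 :: 'v) \<noteq> 0"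
  shows "\<exists>v. weight_vector v \<and> (\<forall>i j. i < j \<longrightarrow> unit i j v = 0)"
proof -
  obtain v where v: "weight_vector v" using weight_vector_exists[OF assms] by blast
  let ?P = "\<lambda>ws. (\<forall>(i, j)\<in>set ws. i < j) \<and> word ws v \<noteq> 0"
  have up: "\<forall>(i, j)\<in>set ws. 1 * height j < 1 * height i" if "?P ws" for ws
    using that height_less by auto
  have "?P []" using v by (simp add: weight_vector_def)
  moreover have "length ws \<le> nat (2 * height_bound)" if "?P ws" for ws
    using word_length_bound[OF v _ _ up[OF that]] that by simp
  ultimately obtain ws where ws: "?P ws" and max: "\<And>ws'. ?P ws' \<Longrightarrow> length ws' \<le> length ws"
    using ex_has_greatest_nat[of ?P "[]" length "nat (2 * height_bound) + 1"] by (metis less_Suc_eq_le Suc_eq_plus1)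
  have "unit i j (word ws v) = 0" if "i < j" for i j
  proof (rule ccontr)
    assume "unit i j (word ws v) \<noteq> 0"
    with ws that have "?P ((i, j) # ws)" by simp
    from max[OF this] show False by simp
  qed
  moreover obtain a where a: "weight_height v a" using weight_height_exists[OF v] by blast
  have "\<exists>b. weight_height (word ws v) b"
    using word_height[OF a _ _ up[OF ws]] ws by auto
  then have "weight_vector (word ws v)" using weight_height_weight_vector by blast
  ultimately show ?thesis by blast
qed

text \<open>
  Lowering words applied to a highest weight vector span a submodule, as in every highest weight module,
  and here only finitely many words act nontrivially.
\<close>

lemma finite_dimensional:
  assumes irr: "irreducible_action sl \<rho>" and v: "weight_vector v"
    and high: "\<And>i j. i < j \<Longrightarrow> unit i j v = 0"
  shows "\<exists>B::'v set. finite B \<and> cspan B = UNIV"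
proof -
  let ?lower = "\<lambda>ws :: ('n \<times> 'n) list. \<forall>(i, j)\<in>set ws. j < i"
  let ?L = "{ws. ?lower ws \<and> length ws \<le> nat (2 * height_bound)}"
  define W where "W = cspan ((\<lambda>ws. word ws v) ` ?L)"
  have W: "csubspace W" unfolding W_def by (rule complex_vector.subspace_span)
  have word_W: "word ws v \<in> W" if "?lower ws" for ws
  proof (cases "word ws v = 0")
    case False
    have "\<forall>(i, j)\<in>set ws. - 1 * height j < - 1 * height i" using that height_less by auto
    from word_length_bound[OF v False _ this] that have "ws \<in> ?L" by simp
    then show ?thesis unfolding W_def by (intro complex_vector.span_base imageI)
  qed (simp add: complex_vector.subspace_0[OF W])
  have lower_W: "unit k l y \<in> W" if "l < k" "y \<in> W" for k l y
    unfolding W_def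
  proof (rule span_image_subset[OF unit_linear])
    fix x assume "x \<in> (\<lambda>ws. word ws v) ` ?L"
    then obtain ws where ws: "x = word ws v" "?lower ws" by blast
    have "word ((k, l) # ws) v \<in> W" by (rule word_W) (use ws that in simp)
    then show "unit k l x \<in> cspan ((\<lambda>ws. word ws v) ` ?L)" by (simp add: ws W_def)
  qed (use that W_def in auto)
  \<comment> \<open>Pull \<open>A\<close> past the first letter; the commutator is again in \<open>sl\<close>, so all of \<open>sl\<close> is treated at once.\<close>
  have act: "\<rho> A (word ws v) \<in> W" if "?lower ws" "A \<in> sl" for ws A
    using that
  proof (induction ws arbitrary: A)
    case Nil
    have vW: "v \<in> W" using word_W[of "[]"] by simp
    from \<open>A \<in> sl\<close> show ?case
    proof (induction rule: sl_induct)
      case (unit i j)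
      then show ?case
        using high[of i j] lower_W[OF _ vW, of j i] complex_vector.subspace_0[OF W]
        by (cases "i < j") auto
    next
      case (diag i j)
      obtain c :: int where "cartan i j v = of_int c *\<^sub>C v" using v unfolding weight_vector_def by blast
      then show ?case using complex_vector.subspace_scale[OF W vW] by simp
    qed (simp_all add: zero add scale complex_vector.subspace_0[OF W]
        complex_vector.subspace_add[OF W] complex_vector.subspace_scale[OF W])
  next
    case (Cons x ws)
    obtain k l where x: "x = (k, l)" by force
    have kl: "l < k" and ws: "?lower ws" using Cons.prems x by auto
    then have E: "matrix_unit k l \<in> sl" by (intro matrix_unit_in_sl) auto
    have "\<rho> A (word (x # ws) v) = unit k l (\<rho> A (word ws v)) + \<rho> (mat_bracket A (matrix_unit k l)) (word ws v)"
      using bracket[OF Cons.prems(2) E] by (simp add: x)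
    also have "\<dots> \<in> W"
      by (intro complex_vector.subspace_add[OF W] lower_W kl Cons.IH ws Cons.prems mat_bracket_in_sl)
    finally show ?case .
  qed
  have "submodule sl \<rho> W"
  proof (rule submoduleI[OF W])
    fix i j :: 'n and y assume ij: "i \<noteq> j" and y: "y \<in> W"
    show "unit i j y \<in> W"
      using y unfolding W_def
    proof (rule span_image_subset[OF unit_linear[OF ij], rotated])
      fix x assume "x \<in> (\<lambda>ws. word ws v) ` ?L"
      then show "unit i j x \<in> cspan ((\<lambda>ws. word ws v) ` ?L)"
        using act[OF _ matrix_unit_in_sl[OF ij]] unfolding W_def by blast
    qed
  qed
  moreover have "v \<in> W" using word_W[of "[]"] by simp
  ultimately have "W = UNIV"
    using irreducible_eq_UNIV[OF irr] v unfolding weight_vector_def by blast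
  moreover have "finite ?L"
    by (rule finite_subset[OF _ finite_lists_length_le[of "UNIV :: ('n \<times> 'n) set" "nat (2 * height_bound)"]]) auto
  ultimately show ?thesis unfolding W_def by blast
qed

text \<open>
  On a highest weight vector \<open>h\<^sup>2 = h\<close> for every positive coroot \<open>h\<close>, so its eigenvalue is \<open>0\<close> or \<open>1\<close>. Two simple coroots with
  eigenvalue \<open>1\<close> would force an eigenvalue of at least \<open>2\<close> on the sum of the simple coroots from one to the
  other, which is a positive coroot too.
\<close>

lemma highest_weight_fundamental:
  assumes v: "weight_vector v" and high: "\<And>i j. i < j \<Longrightarrow> unit i j v = 0"
  shows "\<exists>k\<le>CARD('n) - 1. \<forall>j\<in>{1..CARD('n) - 1}.
    \<rho> (coroot j) v = (if j = k then 1 else 0) *\<^sub>C v"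
proof -
  let ?n = "CARD('n)"
  have v0: "v \<noteq> 0" using v by (simp add: weight_vector_def)
  obtain c :: "'n \<Rightarrow> 'n \<Rightarrow> int" where c: "\<And>i j. cartan i j v = of_int (c i j) *\<^sub>C v"
    using v unfolding weight_vector_def by metis
  have c_add: "c i j + c j k = c i k" for i j k
  proof -
    have "diag_diff i k = diag_diff i j + diag_diff j k" by (simp add: diag_diff_def)
    then have "of_int (c i k) *\<^sub>C v = of_int (c i j + c j k) *\<^sub>C v"
      using add[OF diag_diff_in_sl diag_diff_in_sl, of i j j k v]
      by (simp only: c[symmetric] of_int_add scaleC_add_left)
    then have "complex_of_int (c i k) = of_int (c i j + c j k)" using v0 by (simp only: complex_vector.scale_cancel_right simp_thms)
    then show ?thesis by (simp only: of_int_eq_iff)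
  qed
  have c_range: "c i j = 0 \<or> c i j = 1" if "i < j" for i j
  proof -
    have "cartan i j (cartan i j v) = cartan i j v"
      using that high[OF that]
      by (simp add: cartan_eq[of i j v] cartan_unit_eigen clinear_0[OF unit_linear])
    then have "(of_int (c i j) * of_int (c i j)) *\<^sub>C v = of_int (c i j) *\<^sub>C v"
      by (simp add: c clinear_scale[OF cartan_linear])
    then have "complex_of_int (c i j * c i j) = of_int (c i j)" using v0 by simp
    then show ?thesis by (simp only: of_int_eq_iff) simp
  qed
  let ?e = "nth_index :: nat \<Rightarrow> 'n"
  have e_less: "?e a < ?e b" if "1 \<le> a" "a < b" "b \<le> ?n" for a b
    unfolding nth_index_def
    by (rule sorted_wrt_nth_less[OF strict_sorted_list_of_set]) (use that in auto)
  let ?c = "\<lambda>j. c (?e j) (?e (j + 1))"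
  have range: "?c j = 0 \<or> ?c j = 1" if "j \<in> {1..?n - 1}" for j
    by (rule c_range[OF e_less]) (use that in auto)
  have once: "\<not> (?c a = 1 \<and> ?c b = 1)" if "1 \<le> a" "a < b" "b \<le> ?n - 1" for a b
  proof
    assume "?c a = 1 \<and> ?c b = 1"
    moreover have "c (?e a) (?e (b + 1)) = ?c a + c (?e (a + 1)) (?e b) + ?c b"
      by (simp add: c_add)
    moreover have "0 \<le> c (?e (a + 1)) (?e b)"
    proof (cases "b = a + 1")
      case True
      then show ?thesis using c_add[of "?e b" "?e b" "?e b"] by simp
    next
      case False
      with that have "?e (a + 1) < ?e b" by (intro e_less) linarith+
      then show ?thesis using c_range by fastforce
    qed
    moreover have "?e a < ?e (b + 1)" using that by (intro e_less) linarith+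
    then have "c (?e a) (?e (b + 1)) \<le> 1" using c_range by fastforce
    ultimately show False by linarith
  qed
  have coroot: "\<rho> (coroot j) v = of_int (?c j) *\<^sub>C v" for j
    using c[of "?e j" "?e (j + 1)"] by (simp add: coroot_def diag_diff_def)
  show ?thesis
  proof (cases "\<exists>k\<in>{1..?n - 1}. ?c k = 1")
    case True
    then obtain k where k: "k \<in> {1..?n - 1}" "?c k = 1" by blast
    have "?c j = (if j = k then 1 else 0)" if "j \<in> {1..?n - 1}" for j
      using range[OF that] once[of j k] once[of k j] k that by (cases j k rule: linorder_cases) auto
    with k show ?thesis by (intro exI[of _ k]) (auto simp: coroot)
  next
    case False
    then have "?c j = 0" if "j \<in> {1..?n - 1}" for j using range[OF that] that by blast
    then show ?thesis by (intro exI[of _ 0]) (auto simp: coroot)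
  qed
qed

lemma fundamental_module:
  assumes irr: "irreducible_action sl \<rho>"
  shows "\<exists>k\<le>CARD('n) - 1. is_V_delta k \<rho>"
proof -
  obtain v0 :: 'v where "v0 \<noteq> 0" using irr by (auto simp: irreducible_action_def)
  then obtain v where v: "weight_vector v" and high: "\<And>i j. i < j \<Longrightarrow> unit i j v = 0"
    using highest_weight_vector_exists by blast
  obtain k where k: "k \<le> CARD('n) - 1"
    "\<forall>j\<in>{1..CARD('n) - 1}. \<rho> (coroot j) v = (if j = k then 1 else 0) *\<^sub>C v"
    using highest_weight_fundamental[OF v high] by blast
  then have "is_V_delta k \<rho>"
    unfolding is_V_delta_def
    using lie irr finite_dimensional[OF irr v high] v high by (auto simp: weight_vector_def)
  with k(1) show ?thesis by blast
qed

end

section \<open>Submodules over the divergence zero vector fields\<close>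

lemma tensor_left_compose:
  "clinear f \<Longrightarrow> clinear g \<Longrightarrow> tensor_left f (tensor_left g t) = tensor_left (\<lambda>x. f (g x)) t"
  by (rule tensor_ext[where t = t])
    (simp_all add: clinear_compose[OF clinear_tensor_left clinear_tensor_left] clinear_tensor_left
      clinear_compose tensor_left_pure)

lemma tensor_left_right:
  "clinear f \<Longrightarrow> clinear g \<Longrightarrow> tensor_left f (tensor_right g t) = tensor_right g (tensor_left f t)"
  by (rule tensor_ext[where t = t])
    (simp_all add: clinear_compose[OF clinear_tensor_left clinear_tensor_right]
      clinear_compose[OF clinear_tensor_right clinear_tensor_left] tensor_left_pure tensor_right_pure)

lemma tensor_left_add:
  "clinear f \<Longrightarrow> clinear g \<Longrightarrow> tensor_left (\<lambda>x. f x + g x) t = tensor_left f t + tensor_left g t"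
  by (rule tensor_ext[where t = t])
    (simp_all add: clinear_plus clinear_tensor_left tensor_left_pure pure_tensor_linear)

lemma tensor_left_scale: "clinear f \<Longrightarrow> tensor_left (\<lambda>x. c *\<^sub>C f x) t = c *\<^sub>C tensor_left f t"
  by (rule tensor_ext[where t = t])
    (simp_all add: clinear_scaled clinear_tensor_left tensor_left_pure pure_tensor_linear)

lemma tensor_left_id: "tensor_left (\<lambda>x. x) t = t"
  by (rule tensor_ext[where t = t])
    (simp_all add: clinear_id clinear_tensor_left tensor_left_pure)

lemma (in sl_module) lie_module_tensor_right:
  "lie_module sl mat_bracket (\<lambda>A. tensor_right (\<rho> A) :: ('p::complex_vector, 'v) tensor \<Rightarrow> _)"
  unfolding lie_module_def linear_action_def
proof (intro conjI ballI allI)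
  note sl = complex_vector.subspace_add[OF csubspace_sl] complex_vector.subspace_scale[OF csubspace_sl]
    mat_bracket_in_sl
  note R = clinear_tensor_right[OF linear]
  fix A B :: "'n sqmat" and c and t :: "('p, 'v) tensor"
  assume A: "A \<in> sl"
  show "clinear (tensor_right (\<rho> A) :: ('p, 'v) tensor \<Rightarrow> _)" by (rule R[OF A])
  show "tensor_right (\<rho> (c *\<^sub>C A)) t = c *\<^sub>C tensor_right (\<rho> A) t"
    by (rule tensor_ext[OF R[OF sl(2)[OF A]] clinear_scaled[OF R[OF A]]])
      (simp add: A sl tensor_right_pure[OF linear] scale pure_tensor_linear)
  assume B: "B \<in> sl"
  show "tensor_right (\<rho> (A + B)) t = tensor_right (\<rho> A) t + tensor_right (\<rho> B) t"
    by (rule tensor_ext[OF R[OF sl(1)[OF A B]] clinear_plus[OF R[OF A] R[OF B]]])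
      (simp add: A B sl tensor_right_pure[OF linear] add pure_tensor_linear)
  show "tensor_right (\<rho> (mat_bracket A B)) t = tensor_right (\<rho> A) (tensor_right (\<rho> B) t)
      - tensor_right (\<rho> B) (tensor_right (\<rho> A) t)"
    by (rule tensor_ext[OF R[OF sl(3)] clinear_minus[OF clinear_compose[OF R[OF A] R[OF B]]
          clinear_compose[OF R[OF B] R[OF A]]]])
      (simp add: A B sl tensor_right_pure[OF linear] bracket pure_tensor_linear)
qed

lemma matrix_unit_outer: "matrix_unit i j = outer (axis i 1) (axis j 1)"
  by (simp add: matrix_unit_def outer_def axis_def vec_eq_iff)

lemma pairing_axis_axis: "i \<noteq> j \<Longrightarrow> pairing (axis j 1) (axis i 1) = 0"
  unfolding pairing_axis by (simp add: axis_def)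

lemma scaleC_laurent_mult: "(c *\<^sub>C f) * g = c *\<^sub>C (f * g)" for f g :: "'n::finite laurent"
proof -
  have const: "c *\<^sub>C h = Poly_Mapping.single 0 c * h" for h :: "'n laurent"
    by (rule poly_mapping_eqI) (simp add: lookup_mult lookup_single when_mult)
  show ?thesis unfolding const by (rule mult.assoc)
qed

lemma D_op_add: "D_op (u + v) r = D_op u r + D_op v r"
  by (rule ext, rule poly_mapping_eqI) (simp add: lookup_D_op pairing_add lookup_add distrib_right)

lemma D_op_scale: "D_op (c *\<^sub>C u) r = c *\<^sub>C D_op u r"
  by (rule ext, rule poly_mapping_eqI) (simp add: lookup_D_op pairing_scale)

lemma D_op_monomial: "D_op u r = (\<lambda>g. xpow r * g) \<circ> D_op u 0"
  by (rule ext, rule poly_mapping_eqI) (simp add: lookup_D_op lookup_xpow_times)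

lemma pairing_of_nat: "pairing u (of_nat k * m) = of_nat k * pairing u m"
  by (simp add: pairing_def of_nat_index sum_distrib_left mult_ac)

lemma pairing_diff_right: "pairing u (r - s) = pairing u r - pairing u s"
  using pairing_add_right[of u "r - s" s] by simp

lemma outer_of_nat: "outer (of_nat k * m) u = of_nat k *\<^sub>C outer m u"
  by (simp add: outer_def vec_eq_iff of_nat_index)

lemma outer_diff_left: "outer (r - s) u = outer r u - outer s u"
  by (simp add: outer_def vec_eq_iff algebra_simps)

text \<open>
  If \<open>r\<close> and \<open>m\<close> are independent, this is solving two independent linear equations; otherwise \<open>r\<close> is a
  multiple of \<open>m\<close>, the right hand side vanishes, and \<open>\<alpha> = 0\<close> works.
\<close>

lemma pairing_prescribed:
  assumes "pairing u m = 0" "m \<noteq> 0"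
  obtains \<alpha> :: "complex^'n::finite" where "pairing \<alpha> r = 0" "pairing \<alpha> m = pairing u r"
proof (cases "\<exists>i j. r $ i * m $ j \<noteq> r $ j * m $ i")
  case True
  then obtain i j where ij: "r $ i * m $ j \<noteq> r $ j * m $ i" by blast
  let ?d = "of_int (r $ i * m $ j - r $ j * m $ i) :: complex"
  have d: "?d \<noteq> 0" using ij by (simp only: of_int_eq_0_iff)
  have axis: "pairing (axis l a) q = a * of_int (q $ l)" for l a q
    by (simp add: pairing_def axis_def if_distrib if_distribR cong: if_cong)
  let ?\<alpha> = "(pairing u r / ?d) *\<^sub>C (axis j (of_int (r $ i)) - axis i (of_int (r $ j)))"
  have "pairing ?\<alpha> r = 0" by (simp add: pairing_scale pairing_diff axis)
  moreover have "pairing ?\<alpha> m = pairing u r"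
    using d by (simp add: pairing_scale pairing_diff axis)
  ultimately show ?thesis by (rule that)
next
  case False
  obtain j where j: "m $ j \<noteq> 0" using assms(2) by (auto simp: vec_eq_iff)
  have "of_int (m $ j) * pairing u r = of_int (r $ j) * pairing u m"
    unfolding pairing_def sum_distrib_left
  proof (rule sum.cong)
    fix i
    have "complex_of_int (m $ j) * of_int (r $ i) = of_int (r $ j) * of_int (m $ i)"
      using False by (simp only: of_int_mult[symmetric] mult.commute[of "m $ j"]) simp
    then show "of_int (m $ j) * (u $ i * of_int (r $ i)) = of_int (r $ j) * (u $ i * of_int (m $ i))"
      by (metis mult.left_commute)
  qed simp
  with assms(1) j have "pairing u r = 0" by simp
  then show ?thesis using that[of 0] by (simp add: pairing_zero)
qed

text \<open>
  The two commuting actions on \<open>P \<otimes> V\<close>: differential operators through the first factor, \<open>sl\<close> through the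
  second.
\<close>

locale tensor_field_module = sl_module \<rho>
  for \<pi> :: "'n::finite operator \<Rightarrow> 'p::complex_vector \<Rightarrow> 'p"
    and \<rho> :: "'n sqmat \<Rightarrow> 'v::complex_vector \<Rightarrow> 'v" +
  assumes weyl: "weyl_module \<pi>"
begin

lemma \<pi>_linear: "X \<in> weyl_algebra \<Longrightarrow> clinear (\<pi> X)"
  and \<pi>_add: "X \<in> weyl_algebra \<Longrightarrow> Y \<in> weyl_algebra \<Longrightarrow> \<pi> (X + Y) z = \<pi> X z + \<pi> Y z"
  and \<pi>_scale: "X \<in> weyl_algebra \<Longrightarrow> \<pi> (c *\<^sub>C X) z = c *\<^sub>C \<pi> X z"
  and \<pi>_comp: "X \<in> weyl_algebra \<Longrightarrow> Y \<in> weyl_algebra \<Longrightarrow> \<pi> (X \<circ> Y) z = \<pi> X (\<pi> Y z)"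
  and \<pi>_id: "\<pi> id z = z"
  using weyl by (simp_all add: weyl_module_def linear_action_def)

definition diff_act :: "'n operator \<Rightarrow> ('p, 'v) tensor \<Rightarrow> ('p, 'v) tensor"
  where "diff_act X = tensor_left (\<pi> X)"

definition mat_act :: "'n sqmat \<Rightarrow> ('p, 'v) tensor \<Rightarrow> ('p, 'v) tensor"
  where "mat_act A = tensor_right (\<rho> A)"

sublocale mat: sl_module mat_act
  using lie_module_tensor_right by unfold_locales (simp add: mat_act_def[abs_def])

lemma diff_act_linear: "X \<in> weyl_algebra \<Longrightarrow> clinear (diff_act X)"
  unfolding diff_act_def by (rule clinear_tensor_left[OF \<pi>_linear])

lemma diff_act_add:
  assumes "X \<in> weyl_algebra" "Y \<in> weyl_algebra"
  shows "diff_act (X + Y) t = diff_act X t + diff_act Y t"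
proof -
  have "\<pi> (X + Y) = (\<lambda>z. \<pi> X z + \<pi> Y z)" by (rule ext) (rule \<pi>_add[OF assms])
  then show ?thesis by (simp add: diff_act_def tensor_left_add \<pi>_linear assms)
qed

lemma diff_act_scale:
  assumes "X \<in> weyl_algebra"
  shows "diff_act (c *\<^sub>C X) t = c *\<^sub>C diff_act X t"
proof -
  have "\<pi> (c *\<^sub>C X) = (\<lambda>z. c *\<^sub>C \<pi> X z)" by (rule ext) (rule \<pi>_scale[OF assms])
  then show ?thesis by (simp add: diff_act_def tensor_left_scale \<pi>_linear assms)
qed

lemma diff_act_comp:
  assumes "X \<in> weyl_algebra" "Y \<in> weyl_algebra"
  shows "diff_act (X \<circ> Y) t = diff_act X (diff_act Y t)"
proof -
  have "\<pi> (X \<circ> Y) = (\<lambda>z. \<pi> X (\<pi> Y z))" by (rule ext) (rule \<pi>_comp[OF assms])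
  then show ?thesis by (simp add: diff_act_def tensor_left_compose \<pi>_linear assms)
qed

lemma diff_act_id: "diff_act (\<lambda>g. g) t = t"
proof -
  have "\<pi> (\<lambda>g. g) = (\<lambda>z. z)" using \<pi>_id by (simp add: fun_eq_iff id_def)
  then show ?thesis by (simp add: diff_act_def tensor_left_id)
qed

lemma diff_mat_commute: "X \<in> weyl_algebra \<Longrightarrow> A \<in> sl \<Longrightarrow> diff_act X (mat_act A t) = mat_act A (diff_act X t)"
  unfolding diff_act_def mat_act_def by (rule tensor_left_right[OF \<pi>_linear linear])

abbreviation mult :: "int^'n \<Rightarrow> ('p, 'v) tensor \<Rightarrow> ('p, 'v) tensor"
  where "mult r \<equiv> diff_act (\<lambda>g. xpow r * g)"

abbreviation deriv :: "complex^'n \<Rightarrow> ('p, 'v) tensor \<Rightarrow> ('p, 'v) tensor"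
  where "deriv u \<equiv> diff_act (D_op u 0)"

lemma monomial_in_weyl: "(\<lambda>g. xpow r * g) \<in> weyl_algebra"
  by (rule weyl_algebra.multiplication)

lemmas mult_linear = diff_act_linear[OF monomial_in_weyl]
  and deriv_linear = diff_act_linear[OF D_op_in_weyl]

lemma mult_mult: "mult r (mult s t) = mult (r + s) t"
  by (simp add: diff_act_comp[OF monomial_in_weyl monomial_in_weyl, symmetric] comp_def
      mult.assoc[symmetric] xpow_xpow)

lemma mult_0: "mult 0 t = t"
  by (simp add: diff_act_id)

lemma deriv_mult: "deriv u (mult s t) = mult s (deriv u t) + pairing u s *\<^sub>C mult s t"
  using diff_act_comp[OF D_op_in_weyl[of u 0] monomial_in_weyl[of s], of t]
  by (simp add: D_op_comp_xpow diff_act_add diff_act_scale diff_act_comp D_op_in_weyl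
      monomial_in_weyl weyl_algebra.intros)

lemma deriv_add: "deriv (u + v) t = deriv u t + deriv v t"
  by (simp add: D_op_add diff_act_add D_op_in_weyl)

lemma deriv_scale: "deriv (c *\<^sub>C u) t = c *\<^sub>C deriv u t"
  by (simp add: D_op_scale diff_act_scale D_op_in_weyl)

text \<open>
  The form \<open>x\<^sup>r(\<partial>\<^sub>u + r u\<^sup>T)\<close> of the action of \<open>D(u, r)\<close>, valid on all tensors.
\<close>

lemma F_action_eq:
  assumes "pairing u r = 0"
  shows "F_action \<pi> \<rho> (D_op u r) t = mult r (deriv u t + mat_act (outer r u) t)"
proof (rule tensor_ext[where t = t])
  have sl: "outer r u \<in> sl" using assms by (simp add: outer_in_sl)
  show "clinear (F_action \<pi> \<rho> (D_op u r))"
    using lie_module_F_action[OF weyl lie] D_op_in_S_alg[OF assms]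
    by (simp add: lie_module_def linear_action_def)
  show "clinear (\<lambda>t. mult r (deriv u t + mat_act (outer r u) t))"
    by (rule clinear_compose[OF mult_linear clinear_plus[OF deriv_linear mat.linear[OF sl]]])
  fix z y
  have "\<pi> (D_op u r) z = \<pi> (\<lambda>g. xpow r * g) (\<pi> (D_op u 0) z)"
    by (subst D_op_monomial) (rule \<pi>_comp[OF monomial_in_weyl D_op_in_weyl])
  then show "F_action \<pi> \<rho> (D_op u r) (z \<otimes>\<^sub>t y)
      = mult r (deriv u (z \<otimes>\<^sub>t y) + mat_act (outer r u) (z \<otimes>\<^sub>t y))"
    unfolding F_action_D[OF weyl lie assms] clinear_add[OF mult_linear]
    by (simp add: diff_act_def mat_act_def tensor_left_pure tensor_right_pure \<pi>_linear linear sl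
        monomial_in_weyl D_op_in_weyl)
qed

text \<open>
  The key step. The two conditions on \<open>\<alpha>\<close> say exactly that \<open>\<alpha> + k u\<close> is orthogonal to \<open>r - k m\<close> for all \<open>k\<close>.
  In \<open>D(\<alpha> + k u, r - k m) D(v, k m)\<close> the monomials combine to \<open>x\<^sup>r\<close>, independently of \<open>k\<close>. The matrix
  \<open>(r - k m)(\<alpha> + k u)\<^sup>T\<close> contributes \<open>- k\<^sup>2 m u\<^sup>T\<close> and the second factor contributes \<open>k m v\<^sup>T\<close>; nothing else reaches
  the third power of \<open>k\<close>.
\<close>

lemma square_action_in_submodule:
  assumes M: "submodule S_alg (F_action \<pi> \<rho>) M" and t: "t \<in> M"
    and u: "pairing u m = 0" and v: "pairing v m = 0"
  shows "mult r (mat_act (outer m u) (mat_act (outer m v) t)) \<in> M"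
proof (cases "m = 0")
  case True
  have "csubspace M" using M by (simp add: submodule_def)
  moreover have "outer 0 u = 0" by (simp add: outer_def vec_eq_iff)
  ultimately show ?thesis
    by (simp add: True mat.zero clinear_0[OF mult_linear] complex_vector.subspace_0)
next
  case False
  obtain \<alpha> where \<alpha>: "pairing \<alpha> r = 0" "pairing \<alpha> m = pairing u r"
    using pairing_prescribed[OF u False] by blast
  have sub: "csubspace M" and act: "\<And>X s. X \<in> S_alg \<Longrightarrow> s \<in> M \<Longrightarrow> F_action \<pi> \<rho> X s \<in> M"
    using M by (simp_all add: submodule_def)
  define R where "R = mat_act (outer r \<alpha>)"
  define S where "S = mat_act (outer r u - outer m \<alpha>)"
  define U where "U = mat_act (outer m u)"
  define W where "W = mat_act (outer m v)"
  define p where "p = pairing u r"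
  \<comment> \<open>the coefficients of \<open>k\<^sup>0, \<dots>, k\<^sup>3\<close>, with the common factor \<open>x\<^sup>r\<close> taken out\<close>
  define d where "d i = [deriv \<alpha> (deriv v t) + R (deriv v t),
    deriv \<alpha> (W t) + R (W t) + deriv u (deriv v t) + p *\<^sub>C deriv v t + S (deriv v t),
    deriv u (W t) + p *\<^sub>C W t + S (W t) - U (deriv v t),
    - U (W t)] ! i" for i
  have sl: "outer r \<alpha> \<in> sl" "outer r u - outer m \<alpha> \<in> sl" "outer m u \<in> sl" "outer m v \<in> sl"
    using \<alpha> u v by (simp_all add: sl_def trace_sub outer_in_sl[unfolded sl_def, simplified])
      (simp_all add: trace_def outer_def pairing_def mult.commute)
  note lin = mat.linear[OF sl(1), folded R_def] mat.linear[OF sl(2), folded S_def]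
    mat.linear[OF sl(3), folded U_def] mat.linear[OF sl(4), folded W_def]
  have "(\<Sum>i\<le>3. of_nat k ^ i *\<^sub>C mult r (d i)) \<in> M" for k
  proof -
    let ?a = "\<alpha> + of_nat k *\<^sub>C u" and ?s = "r - of_nat k * m"
    let ?w = "deriv v t + of_nat k *\<^sub>C W t"
    have v': "pairing v (of_nat k * m) = 0" by (simp add: pairing_of_nat v)
    have a: "pairing ?a ?s = 0"
      by (simp only: pairing_add pairing_scale pairing_diff_right pairing_of_nat \<alpha> u) simp
    have a': "pairing ?a (of_nat k * m) = of_nat k * p"
      by (simp add: pairing_add pairing_scale pairing_of_nat \<alpha> u p_def)
    have outer: "outer ?s ?a = outer r \<alpha> + of_nat k *\<^sub>C (outer r u - outer m \<alpha>)
        - (of_nat k * of_nat k) *\<^sub>C outer m u"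
      unfolding outer_diff_left outer_of_nat outer_add outer_scale
      by (simp add: vec_eq_iff algebra_simps)
    have mat: "mat_act (outer ?s ?a) x = R x + of_nat k *\<^sub>C S x - (of_nat k * of_nat k) *\<^sub>C U x" for x
      unfolding outer R_def S_def U_def
      by (simp add: mat.diff mat.add mat.scale sl complex_vector.subspace_add[OF csubspace_sl]
          complex_vector.subspace_scale[OF csubspace_sl])
    have sl': "outer ?s ?a \<in> sl" using a by (simp add: outer_in_sl)
    have "F_action \<pi> \<rho> (D_op v (of_nat k * m)) t = mult (of_nat k * m) ?w"
      by (simp add: F_action_eq[OF v'] outer_of_nat mat.scale[OF sl(4)] W_def)
    then have "F_action \<pi> \<rho> (D_op ?a ?s) (F_action \<pi> \<rho> (D_op v (of_nat k * m)) t)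
        = mult ?s (deriv ?a (mult (of_nat k * m) ?w) + mult (of_nat k * m) (mat_act (outer ?s ?a) ?w))"
      by (simp only: F_action_eq[OF a] diff_mat_commute[OF monomial_in_weyl sl'])
    also have "\<dots> = mult r (deriv ?a ?w + (of_nat k * p) *\<^sub>C ?w + mat_act (outer ?s ?a) ?w)"
      unfolding deriv_mult a'
      by (simp only: clinear_add[OF mult_linear] clinear_scale[OF mult_linear] mult_mult diff_add_cancel)
    also have "deriv ?a ?w + (of_nat k * p) *\<^sub>C ?w + mat_act (outer ?s ?a) ?w
        = (\<Sum>i\<le>3. of_nat k ^ i *\<^sub>C d i)"
      unfolding mat
      by (simp add: d_def eval_nat_numeral deriv_add deriv_scale
          clinear_add[OF deriv_linear] clinear_scale[OF deriv_linear]
          clinear_add[OF lin(1)] clinear_add[OF lin(2)] clinear_add[OF lin(3)]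
          clinear_scale[OF lin(1)] clinear_scale[OF lin(2)] clinear_scale[OF lin(3)]
          scaleC_add_right complex_vector.scale_right_diff_distrib scaleC_one algebra_simps)
    also have "mult r \<dots> = (\<Sum>i\<le>3. of_nat k ^ i *\<^sub>C mult r (d i))"
      by (simp only: clinear_sum[OF mult_linear] clinear_scale[OF mult_linear])
    finally show ?thesis using act[OF D_op_in_S_alg[OF a] act[OF D_op_in_S_alg[OF v'] t]] by simp
  qed
  from poly_coeffs_in_subspace[OF sub this, of 3] have "mult r (d 3) \<in> M" by simp
  then have "- mult r (d 3) \<in> M" by (rule complex_vector.subspace_neg[OF sub])
  moreover have "- mult r (d 3) = mult r (U (W t))"
    using clinear_scale[OF mult_linear, of r "- 1" "U (W t)"] by (simp add: d_def)
  ultimately show ?thesis by (simp add: U_def W_def)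
qed

text \<open>
  The largest subspace of \<open>M\<close> that is stable under multiplication by Laurent polynomials.
\<close>

definition mult_core :: "('p, 'v) tensor set \<Rightarrow> ('p, 'v) tensor set"
  where "mult_core M = {t. \<forall>r. mult r t \<in> M}"

context
  fixes M
  assumes M: "submodule S_alg (F_action \<pi> \<rho>) M"
begin

lemma csubspace_mult_core: "csubspace (mult_core M)"
  using M unfolding submodule_def mult_core_def
  by (auto intro!: complex_vector.subspaceI simp: clinear_0[OF mult_linear] clinear_add[OF mult_linear]
      clinear_scale[OF mult_linear] complex_vector.subspace_0 complex_vector.subspace_add
      complex_vector.subspace_scale)

lemma mult_core_subset: "mult_core M \<subseteq> M"
  unfolding mult_core_def using mult_0 by (metis (mono_tags, lifting) mem_Collect_eq subsetI)

lemma mult_core_mult: "t \<in> mult_core M \<Longrightarrow> mult r t \<in> mult_core M"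
  by (simp add: mult_core_def mult_mult)

text \<open>
  \<open>\<partial>\<^sub>u = D(u, 0)\<close> belongs to \<open>\<S>\<^sub>n\<close> for every \<open>u\<close>, and its commutator with \<open>x\<^sup>s\<close> is a multiple of \<open>x\<^sup>s\<close>.
\<close>

lemma mult_core_deriv:
  assumes "t \<in> mult_core M"
  shows "deriv u t \<in> mult_core M"
  unfolding mult_core_def
proof (intro CollectI allI)
  fix s
  have sub: "csubspace M" using M by (simp add: submodule_def)
  have t: "mult s t \<in> M" using assms by (simp add: mult_core_def)
  have u: "pairing u 0 = 0" by (simp add: pairing_def)
  have "F_action \<pi> \<rho> (D_op u 0) (mult s t) \<in> M"
    using M t D_op_in_S_alg[OF u] by (simp add: submodule_def)
  moreover have "outer 0 u = 0" by (simp add: outer_def vec_eq_iff)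
  ultimately have "deriv u (mult s t) \<in> M" by (simp add: F_action_eq[OF u] diff_act_id mat.zero)
  then have "deriv u (mult s t) - pairing u s *\<^sub>C mult s t \<in> M"
    by (intro complex_vector.subspace_diff[OF sub] complex_vector.subspace_scale[OF sub] t)
  then show "mult s (deriv u t) \<in> M" by (simp add: deriv_mult)
qed

text \<open>
  \<open>x\<^sup>s (r u\<^sup>T) t = D(u, r) x\<^sup>s\<^sup>-\<^sup>r t - x\<^sup>r \<partial>\<^sub>u x\<^sup>s\<^sup>-\<^sup>r t\<close>, and both terms on the right lie in \<open>M\<close>.
\<close>

lemma mult_core_outer:
  assumes "t \<in> mult_core M" and u: "pairing u r = 0"
  shows "mat_act (outer r u) t \<in> mult_core M"
  unfolding mult_core_def
proof (intro CollectI allI)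
  fix s
  have sub: "csubspace M" using M by (simp add: submodule_def)
  have sl: "outer r u \<in> sl" using u by (simp add: outer_in_sl)
  let ?t = "mult (s - r) t"
  have "?t \<in> mult_core M" by (rule mult_core_mult[OF assms(1)])
  then have "mult r (deriv u ?t) \<in> M" "?t \<in> M"
    using mult_core_deriv mult_core_subset by (auto simp: mult_core_def)
  moreover from this have "F_action \<pi> \<rho> (D_op u r) ?t \<in> M"
    using M D_op_in_S_alg[OF u] by (simp add: submodule_def)
  ultimately have "F_action \<pi> \<rho> (D_op u r) ?t - mult r (deriv u ?t) \<in> M"
    by (intro complex_vector.subspace_diff[OF sub])
  then show "mult s (mat_act (outer r u) t) \<in> M"
    by (simp add: F_action_eq[OF u] clinear_add[OF mult_linear]
        diff_mat_commute[OF monomial_in_weyl sl] mult_mult)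
qed

lemma submodule_sl_mult_core: "submodule sl mat_act (mult_core M)"
proof (rule mat.submoduleI[OF csubspace_mult_core])
  fix i j :: 'n and t assume ij: "i \<noteq> j" and t: "t \<in> mult_core M"
  show "mat_act (matrix_unit i j) t \<in> mult_core M"
    unfolding matrix_unit_outer by (rule mult_core_outer[OF t pairing_axis_axis[OF ij]])
qed

lemma mult_core_weyl: "X \<in> weyl_algebra \<Longrightarrow> t \<in> mult_core M \<Longrightarrow> diff_act X t \<in> mult_core M"
proof (induction arbitrary: t rule: weyl_algebra.induct)
  case (multiplication f)
  note C = csubspace_mult_core
  have zero: "diff_act (\<lambda>g. 0) t \<in> mult_core M"
    using diff_act_scale[OF monomial_in_weyl, of 0 0 t] complex_vector.subspace_0[OF C]
    by (simp add: zero_fun_def)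
  have sum: "diff_act (\<lambda>g. (\<Sum>s\<in>S. a s *\<^sub>C xpow s) * g) t \<in> mult_core M" for S and a :: "int^'n \<Rightarrow> complex"
  proof (induction S rule: infinite_finite_induct)
    case (insert s S)
    have "(\<lambda>g. (\<Sum>s\<in>insert s S. a s *\<^sub>C xpow s) * g)
        = a s *\<^sub>C (\<lambda>g. xpow s * g) + (\<lambda>g. (\<Sum>s\<in>S. a s *\<^sub>C xpow s) * g)"
    proof
      fix g :: "'n laurent"
      show "(\<Sum>s\<in>insert s S. a s *\<^sub>C xpow s) * g
          = (a s *\<^sub>C (\<lambda>g. xpow s * g) + (\<lambda>g. (\<Sum>s\<in>S. a s *\<^sub>C xpow s) * g)) g"
        by (simp only: sum.insert[OF insert(1,2)] distrib_right scaleC_laurent_mult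
            plus_fun_apply scaleC_fun_apply)
    qed
    then show ?case
      using insert.IH mult_core_mult[OF multiplication, of s]
      by (simp add: diff_act_add diff_act_scale monomial_in_weyl weyl_algebra.intros
          complex_vector.subspace_add[OF C] complex_vector.subspace_scale[OF C]
          del: plus_fun_apply scaleC_fun_apply)
  qed (simp_all add: zero)
  have "(\<Sum>k\<in>Poly_Mapping.keys f. Poly_Mapping.lookup f k *\<^sub>C xpow k) = f"
    by (rule poly_mapping_eqI)
      (simp add: sum_lookup lookup_single when_def if_distrib[of "\<lambda>x. _ * x"] in_keys_iff cong: if_cong)
  with sum[of "Poly_Mapping.lookup f" "Poly_Mapping.keys f"] show ?case by simp
next
  case (derivation i)
  have "partial i = D_op (axis i 1) 0"
    by (rule ext, rule poly_mapping_eqI)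
      (simp add: lookup_D_op partial.rep_eq pairing_def axis_def if_distrib if_distribR cong: if_cong)
  then show ?case using mult_core_deriv[OF derivation] by simp
next
  case (add X Y)
  then show ?case
    by (simp only: diff_act_add complex_vector.subspace_add[OF csubspace_mult_core])
next
  case (scale X c)
  then show ?case
    by (simp only: diff_act_scale complex_vector.subspace_scale[OF csubspace_mult_core])
next
  case (compose X Y)
  then show ?case by (simp only: diff_act_comp)
qed

end

end

theorem theorem3p3:
  fixes \<pi> :: "'n::{finite,linorder} operator \<Rightarrow> 'p::complex_vector \<Rightarrow> 'p"
    and \<rho> :: "'n sqmat \<Rightarrow> 'v::complex_vector \<Rightarrow> 'v"
  assumes n_ge_2: "CARD('n) \<ge> 2"
    and P: "weyl_module \<pi>" "irreducible_action weyl_algebra \<pi>"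
    and V: "lie_module sl mat_bracket \<rho>" "irreducible_action sl \<rho>"
    and not_V_delta: "\<And>k (\<sigma> :: 'n sqmat \<Rightarrow> 'v \<Rightarrow> 'v).
      k \<le> CARD('n) - 1 \<Longrightarrow> is_V_delta k \<sigma> \<Longrightarrow> \<not> module_isomorphic sl \<rho> \<sigma>"
  shows "lie_module S_alg op_bracket (F_action \<pi> \<rho>) \<and>
    irreducible_action S_alg (F_action \<pi> \<rho>)"
proof
  show "lie_module S_alg op_bracket (F_action \<pi> \<rho>)" by (rule lie_module_F_action[OF P(1) V(1)])
  interpret tensor_field_module \<pi> \<rho> by unfold_locales (rule V(1) P(1))+
  obtain B :: "'p set" where B: "complex_vector.independent B" "cspan B = UNIV"
    by (rule basis_obtain)
  have kernel: "square_kernel = {0}"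
  proof (rule ccontr)
    assume "square_kernel \<noteq> {0}"
    then have all: "square_kernel = UNIV"
      using submodule_square_kernel V(2) unfolding irreducible_action_def by blast
    interpret square_zero_module \<rho>
    proof
      fix i j :: 'n and y assume ij: "i \<noteq> j"
      have "y \<in> square_kernel" using all by simp
      then show "unit i j (unit i j y) = 0"
        using pairing_axis_axis[OF ij] unfolding square_kernel_def matrix_unit_outer by blast
    qed
    obtain k where k: "k \<le> CARD('n) - 1" "is_V_delta k \<rho>" using fundamental_module[OF V(2)] by blast
    have "module_isomorphic sl \<rho> \<rho>"
      unfolding module_isomorphic_def by (intro exI[of _ "\<lambda>v. v"]) (simp add: clinear_id bij_id[unfolded id_def])
    with not_V_delta[OF k] show False by blast
  qed
  obtain C :: "'v set" where C: "countable C" "cspan C = UNIV"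
    using countable_spanning_set[OF V(2)] by blast
  have "M = UNIV" if M: "submodule S_alg (F_action \<pi> \<rho>) M" "M \<noteq> {0}" for M
  proof -
    have "csubspace M" using M(1) by (simp add: submodule_def)
    with M(2) obtain t where t: "t \<in> M" "t \<noteq> 0" using complex_vector.subspace_0 by blast
    obtain b where b: "coordinate B b t \<noteq> 0" using coordinates_eq_0[OF B, of t] t(2) by blast
    then have "coordinate B b t \<notin> square_kernel" by (simp add: kernel)
    then obtain m u v where uv: "pairing u m = 0" "pairing v m = 0"
      and ne: "\<rho> (outer m u) (\<rho> (outer m v) (coordinate B b t)) \<noteq> 0"
      unfolding square_kernel_def by blast
    let ?t = "mat_act (outer m u) (mat_act (outer m v) t)"
    have "coordinate B b ?t \<noteq> 0"
      using ne uv by (simp add: mat_act_def coordinate_tensor_right[OF B linear] outer_in_sl)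
    then have "?t \<noteq> 0" using clinear_0[OF clinear_coordinate[OF B]] by metis
    moreover have "?t \<in> mult_core M"
      unfolding mult_core_def using square_action_in_submodule[OF M(1) t(1) uv] by blast
    ultimately have "mult_core M \<noteq> {0}" by blast
    have "mult_core M = UNIV"
    proof (rule irreducible_tensor_product[OF P(2) V(2) \<pi>_linear linear])
      show "\<exists>c. \<forall>v. \<phi> v = c *\<^sub>C v"
        if "clinear \<phi>" "\<And>X v. X \<in> sl \<Longrightarrow> \<phi> (\<rho> X v) = \<rho> X (\<phi> v)" for \<phi>
        by (rule schur_countable_dimension[OF V(2) linear C that])
      show "csubspace (mult_core M)" by (rule csubspace_mult_core[OF M(1)])
      show "mult_core M \<noteq> {0}" by fact
      show "tensor_left (\<pi> X) t \<in> mult_core M" if "X \<in> weyl_algebra" "t \<in> mult_core M" for X t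
        using mult_core_weyl[OF M(1) that] by (simp add: diff_act_def)
      show "tensor_right (\<rho> A) t \<in> mult_core M" if "A \<in> sl" "t \<in> mult_core M" for A t
        using submodule_sl_mult_core[OF M(1)] that by (simp add: submodule_def mat_act_def)
    qed
    then show ?thesis using mult_core_subset[OF M(1)] by blast
  qed
  moreover have "\<exists>t :: ('p, 'v) tensor. t \<noteq> 0"
  proof -
    obtain z :: 'p and y :: 'v where zy: "z \<noteq> 0" "y \<noteq> 0"
      using P(2) V(2) by (auto simp: irreducible_action_def)
    have "z = (\<Sum>b | complex_vector.representation B z b \<noteq> 0. complex_vector.representation B z b *\<^sub>C b)"
      using complex_vector.sum_nonzero_representation_eq[OF B(1), of z] B(2) by simp
    with zy(1) have "\<exists>b. complex_vector.representation B z b \<noteq> 0"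
      by (metis (mono_tags, lifting) sum.not_neutral_contains_not_neutral mem_Collect_eq)
    then obtain b where "coordinate B b (z \<otimes>\<^sub>t y) \<noteq> 0"
      using zy(2) by (auto simp: coordinate_pure[OF B])
    then show ?thesis using clinear_0[OF clinear_coordinate[OF B]] by metis
  qed
  ultimately show "irreducible_action S_alg (F_action \<pi> \<rho>)"
    unfolding irreducible_action_def by blast
qed

end
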